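(* Let $\Omega\subset\mathbb{R}^n$ be a domain with the following property: for any $z\in\partial\Omega$ and any $s>0$ small, there exist $\nu\in C(\overline{\Omega}\cap B_s(z);\mathbb{R}^n)$ and $c>0$ small such that $B_{c\tau}(y+\tau\nu(y))\subset\Omega$ for all $y\in\overline{\Omega}\cap B_s(z)$ and $0<\tau\le c$. Let $H\in C(\Omega\times\mathbb{R}\times\mathbb{R}^n\times\mathbb{S}^n)$ be an elliptic operator, i.e. $H(x,r,p,X)\le H(x,r,p,Y)$ for all $x\in\Omega$, $r\in\mathbb{R}$, $p\in\mathbb{R}^n$ and $X,Y\in\mathbb{S}^n$ with $X\ge Y$. Let $T>0$, $x_0\in\partial\Omega$ and $0<t_0<T$. Assume that there exists $G_0\in C(\mathbb{R})$ (depending on $x_0$) such that for any modulus of continuity $\omega$, $$\sup\{|H(x,r,p,X)-G_0(r)|:\ x\in\Omega,\ |x-x_0|\le\delta,\ r\in\mathbb{R},\ |p|\le\omega(\delta)/\delta,\ |X|\le\omega(\delta)/\delta^2\}\to0\quad\text{as }\delta\to0.$$ If $u\in USC(\Omega_T)$ (resp. $u\in LSC(\Omega_T)$) is a bounded viscosity subsolution (resp. supersolution) of $$u_t+H(x,u,\nabla u,\nabla^2u)=0\quad\text{in }\Omega_T=\Omega\times(0,T),$$ and $u^\ast$ (resp. $u_\ast$) is continuous at $(x_0,t_0)$, then $$\varphi_t(x_0,t_0)+G_0(u^\ast(x_0,t_0))\le0\qquad\left(\text{resp. }\varphi_t(x_0,t_0)+G_0(u_\ast(x_0,t_0))\ge0\right)$$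 holds whenever $\varphi\in C^2(\overline{\Omega}\times(0,T))$ is such that $u^\ast-\varphi$ (resp. $u_\ast-\varphi$) attains a local maximum (resp. local minimum) in $\overline{\Omega}\times(0,T)$ at $(x_0,t_0)$.
   Context: $\mathbb{S}^n$ is the set of all real symmetric $n\times n$ matrices with the usual partial order; $B_r(x)$ is the open ball centered at $x$ with radius $r$; $\nabla,\nabla^2$ are the gradient and Hessian in the space variable. $USC(S)$ and $LSC(S)$ are the classes of upper and lower semicontinuous functions in $S$. A modulus of continuity is a nonnegative increasing function $\omega\in C([0,\infty))$ with $\omega(0)=0$. For a bounded function $u$ in a set $S$, $u^\ast$ and $u_\ast$ are its semicontinuous envelopes on $\overline{S}$: for $z\in\overline{S}$, $u^\ast(z)=\lim_{\delta\to0}\sup\{u(w):w\in S,|w-z|\le\delta\}$ and $u_\ast(z)=\lim_{\delta\to0}\inf\{u(w):w\in S,|w-z|\le\delta\}$; here $S=\Omega_T$, and the envelopes are considered on $\overline{\Omega}\times(0,T)$. Viscosity solutions. A locally bounded $u\in USC(\Omega_T)$ (resp. $LSC(\Omega_T)$) is a viscosity subsolution (resp. supersolution) of $u_t+H(x,u,\nabla u,\nabla^2u)=0$ in $\Omega_T$ if whenever $(y,s)\in\Omega_T$ and $\varphi\in C^2(\Omega_T)$ are such that $u-\varphi$ attains a local maximum (resp. minimum) at $(y,s)$, one has $\varphi_t(y,s)+H(y,u(y,s),\nabla\varphi(y,s),\nabla^2\varphi(y,s))\le0$ (resp. $\ge0$). *)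

theory Defs
  imports "HOL-Analysis.Analysis"
begin

definition sym_matrices :: "(real^'n^'n) set" where
  "sym_matrices = {X. transpose X = X}"

text \<open>The usual partial order on symmetric matrices.\<close>

definition loewner_le :: "real^'n^'n \<Rightarrow> real^'n^'n \<Rightarrow> bool" where
  "loewner_le X Y \<longleftrightarrow> (\<forall>v. v \<bullet> (X *v v) \<le> v \<bullet> (Y *v v))"

definition modulus_of_continuity :: "(real \<Rightarrow> real) \<Rightarrow> bool" where
  "modulus_of_continuity \<omega> \<longleftrightarrow>
     continuous_on {0..} \<omega> \<and> mono_on {0..} \<omega> \<and> (\<forall>x\<ge>0. 0 \<le> \<omega> x) \<and> \<omega> 0 = 0"


definition usc_on :: "'a::topological_space set \<Rightarrow> ('a \<Rightarrow> real) \<Rightarrow> bool" where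
  "usc_on S u \<longleftrightarrow> (\<forall>z\<in>S. \<forall>a > u z. \<forall>\<^sub>F w in at z within S. u w < a)"

definition lsc_on :: "'a::topological_space set \<Rightarrow> ('a \<Rightarrow> real) \<Rightarrow> bool" where
  "lsc_on S u \<longleftrightarrow> (\<forall>z\<in>S. \<forall>a < u z. \<forall>\<^sub>F w in at z within S. a < u w)"

definition locally_bounded_on :: "'a::metric_space set \<Rightarrow> ('a \<Rightarrow> real) \<Rightarrow> bool" where
  "locally_bounded_on S u \<longleftrightarrow> (\<forall>z\<in>S. \<exists>e>0. bounded (u ` (S \<inter> ball z e)))"

text \<open>Semicontinuous envelopes; meaningful for \<^term>\<open>u\<close> bounded on \<^term>\<open>S\<close> and
  \<^term>\<open>z \<in> closure S\<close>.\<close>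

definition upper_envelope :: "'a::metric_space set \<Rightarrow> ('a \<Rightarrow> real) \<Rightarrow> 'a \<Rightarrow> real" where
  "upper_envelope S u z = Lim (at_right 0) (\<lambda>\<delta>. SUP w\<in>S \<inter> cball z \<delta>. u w)"

definition lower_envelope :: "'a::metric_space set \<Rightarrow> ('a \<Rightarrow> real) \<Rightarrow> 'a \<Rightarrow> real" where
  "lower_envelope S u z = Lim (at_right 0) (\<lambda>\<delta>. INF w\<in>S \<inter> cball z \<delta>. u w)"

definition local_max_on :: "'a::topological_space set \<Rightarrow> ('a \<Rightarrow> real) \<Rightarrow> 'a \<Rightarrow> bool" where
  "local_max_on S f z \<longleftrightarrow> z \<in> S \<and> (\<forall>\<^sub>F w in at z within S. f w \<le> f z)"

definition local_min_on :: "'a::topological_space set \<Rightarrow> ('a \<Rightarrow> real) \<Rightarrow> 'a \<Rightarrow> bool" where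
  "local_min_on S f z \<longleftrightarrow> z \<in> S \<and> (\<forall>\<^sub>F w in at z within S. f z \<le> f w)"


text \<open>For \<^term>\<open>U\<close> open and \<^term>\<open>U \<subseteq> S\<close>, \<^term>\<open>S \<subseteq> closure U\<close>: the function is twice
  continuously differentiable in \<^term>\<open>U\<close>, and it and its derivatives up to order two extend
  continuously to \<^term>\<open>S\<close>. With \<^term>\<open>S = U\<close> this is the class of \<open>C\<^sup>2\<close> functions on the open
  set \<^term>\<open>U\<close>.\<close>

definition C2_up_to ::
  "'a::real_normed_vector set \<Rightarrow> 'a set \<Rightarrow> ('a \<Rightarrow> real) \<Rightarrow> bool" where
  "C2_up_to U S f \<longleftrightarrow>
     (\<exists>(f' :: 'a \<Rightarrow> 'a \<Rightarrow>\<^sub>L real) (f'' :: 'a \<Rightarrow> 'a \<Rightarrow>\<^sub>L ('a \<Rightarrow>\<^sub>L real)).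
        (\<forall>x\<in>U. (f has_derivative blinfun_apply (f' x)) (at x) \<and>
               (f' has_derivative blinfun_apply (f'' x)) (at x)) \<and>
        continuous_on S f \<and> continuous_on S f' \<and> continuous_on S f'')"

definition gradient :: "(real^'n \<Rightarrow> real) \<Rightarrow> real^'n \<Rightarrow> real^'n" where
  "gradient f x = (THE D. GDERIV f x :> D)"

definition hessian :: "(real^'n \<Rightarrow> real) \<Rightarrow> real^'n \<Rightarrow> real^'n^'n" where
  "hessian f x = jacobian (gradient f) (at x)"

definition time_deriv :: "((real^'n) \<times> real \<Rightarrow> real) \<Rightarrow> (real^'n) \<times> real \<Rightarrow> real" where
  "time_deriv \<phi> = (\<lambda>(y, s). deriv (\<lambda>t. \<phi> (y, t)) s)"

definition space_gradient ::
  "((real^'n) \<times> real \<Rightarrow> real) \<Rightarrow> (real^'n) \<times> real \<Rightarrow> real^'n" where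
  "space_gradient \<phi> = (\<lambda>(y, s). gradient (\<lambda>x. \<phi> (x, s)) y)"

definition space_hessian ::
  "((real^'n) \<times> real \<Rightarrow> real) \<Rightarrow> (real^'n) \<times> real \<Rightarrow> real^'n^'n" where
  "space_hessian \<phi> = (\<lambda>(y, s). hessian (\<lambda>x. \<phi> (x, s)) y)"


definition visc_subsolution ::
  "(real^'n) set \<Rightarrow> real \<Rightarrow> (real^'n \<Rightarrow> real \<Rightarrow> real^'n \<Rightarrow> real^'n^'n \<Rightarrow> real)
     \<Rightarrow> ((real^'n) \<times> real \<Rightarrow> real) \<Rightarrow> bool" where
  "visc_subsolution \<Omega> T H u \<longleftrightarrow>
     (let \<Omega>T = \<Omega> \<times> {0<..<T} in
      locally_bounded_on \<Omega>T u \<and> usc_on \<Omega>T u \<and>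
      (\<forall>y s \<phi>. (y, s) \<in> \<Omega>T \<and> C2_up_to \<Omega>T \<Omega>T \<phi> \<and>
          local_max_on \<Omega>T (\<lambda>w. u w - \<phi> w) (y, s) \<longrightarrow>
          time_deriv \<phi> (y, s)
            + H y (u (y, s)) (space_gradient \<phi> (y, s)) (space_hessian \<phi> (y, s)) \<le> 0))"

definition visc_supersolution ::
  "(real^'n) set \<Rightarrow> real \<Rightarrow> (real^'n \<Rightarrow> real \<Rightarrow> real^'n \<Rightarrow> real^'n^'n \<Rightarrow> real)
     \<Rightarrow> ((real^'n) \<times> real \<Rightarrow> real) \<Rightarrow> bool" where
  "visc_supersolution \<Omega> T H u \<longleftrightarrow>
     (let \<Omega>T = \<Omega> \<times> {0<..<T} in
      locally_bounded_on \<Omega>T u \<and> lsc_on \<Omega>T u \<and>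
      (\<forall>y s \<phi>. (y, s) \<in> \<Omega>T \<and> C2_up_to \<Omega>T \<Omega>T \<phi> \<and>
          local_min_on \<Omega>T (\<lambda>w. u w - \<phi> w) (y, s) \<longrightarrow>
          time_deriv \<phi> (y, s)
            + H y (u (y, s)) (space_gradient \<phi> (y, s)) (space_hessian \<phi> (y, s)) \<ge> 0))"

definition elliptic_on ::
  "(real^'n) set \<Rightarrow> (real^'n \<Rightarrow> real \<Rightarrow> real^'n \<Rightarrow> real^'n^'n \<Rightarrow> real) \<Rightarrow> bool" where
  "elliptic_on \<Omega> H \<longleftrightarrow>
     (\<forall>x\<in>\<Omega>. \<forall>r p. \<forall>X\<in>sym_matrices. \<forall>Y\<in>sym_matrices.
        loewner_le Y X \<longrightarrow> H x r p X \<le> H x r p Y)"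

definition uniform_inner_ball_property :: "(real^'n) set \<Rightarrow> bool" where
  "uniform_inner_ball_property \<Omega> \<longleftrightarrow>
     (\<forall>z\<in>frontier \<Omega>. \<forall>\<^sub>F s in at_right 0.
        \<exists>(\<nu> :: real^'n \<Rightarrow> real^'n) c.
          continuous_on (closure \<Omega> \<inter> ball z s) \<nu> \<and> c > 0 \<and>
          (\<forall>y \<in> closure \<Omega> \<inter> ball z s. \<forall>\<tau>. 0 < \<tau> \<and> \<tau> \<le> c \<longrightarrow>
             ball (y + \<tau> *\<^sub>R \<nu> y) (c * \<tau>) \<subseteq> \<Omega>))"

text \<open>The supremum is taken in \<^typ>\<open>ereal\<close> because it may be infinite.\<close>

definition singular_limit_at ::
  "(real^'n) set \<Rightarrow> (real^'n \<Rightarrow> real \<Rightarrow> real^'n \<Rightarrow> real^'n^'n \<Rightarrow> real)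
     \<Rightarrow> real^'n \<Rightarrow> (real \<Rightarrow> real) \<Rightarrow> bool" where
  "singular_limit_at \<Omega> H x0 G0 \<longleftrightarrow>
     (\<forall>\<omega>. modulus_of_continuity \<omega> \<longrightarrow>
        ((\<lambda>\<delta>. SUP (x, r, p, X) \<in> {(x, r, p, X). x \<in> \<Omega> \<and> norm (x - x0) \<le> \<delta> \<and>
                 norm p \<le> \<omega> \<delta> / \<delta> \<and> X \<in> sym_matrices \<and> norm X \<le> \<omega> \<delta> / \<delta>\<^sup>2}.
               ereal \<bar>H x r p X - G0 r\<bar>) \<longlongrightarrow> 0) (at_right 0))"

end

theory Submission
  imports Defs
begin

text \<open>By the inner ball property there are a vector \<open>\<mu>\<close> and \<open>a > 0\<close> such that the balls of radius
  \<open>a\<delta>\<close> around \<open>\<xi> = x0 + \<delta>\<mu>\<close> lie in \<open>\<Omega>\<close> for small \<open>\<delta>\<close>. Maximise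
  \<open>u (x, t) - \<phi> (\<xi>, t) - (t - t0)\<^sup>2 - k |x - \<xi>|\<^sup>2\<close> over \<open>|x - \<xi>| \<le> a\<delta>\<close>, \<open>|t - t0| \<le> \<eta>\<close>, where
  \<open>k = E(\<delta>) / (a\<delta>)\<^sup>2\<close>. Since \<open>u\<^sup>* - \<phi>\<close> has a local maximum at \<open>(x0, t0)\<close>, \<open>u\<^sup>*\<close> is continuous there and
  \<open>\<phi>\<close> is Lipschitz on the ball, an error \<open>E(\<delta>) \<rightarrow> 0\<close> can be chosen such that the maximum is interior.
  The test function has spatial gradient of size \<open>O(E(\<delta>)/\<delta>)\<close> and Hessian of size
  \<open>O(E(\<delta>)/\<delta>\<^sup>2)\<close>, so after majorising \<open>E\<close> by a modulus of continuity the operator \<open>H\<close> may be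
  replaced by \<open>G0\<close> in the limit. Supersolutions reduce to this case by passing to \<open>- u\<close> and
  \<open>- H x (- r) (- p) (- X)\<close>.\<close>

section \<open>Semicontinuous functions and moduli of continuity\<close>

lemma usc_on_subset: "usc_on S f \<Longrightarrow> A \<subseteq> S \<Longrightarrow> usc_on A f"
  unfolding usc_on_def by (meson filter_leD at_le subsetD)

lemma usc_on_diff_continuous:
  fixes f g :: "'a::topological_space \<Rightarrow> real"
  assumes f: "usc_on S f" and g: "continuous_on S g"
  shows "usc_on S (\<lambda>w. f w - g w)"
  unfolding usc_on_def
proof (intro ballI allI impI)
  fix z c assume z: "z \<in> S" and c: "c > f z - g z"
  define h where "h = (c - (f z - g z)) / 2"
  have "h > 0" using c by (simp add: h_def)
  have "\<forall>\<^sub>F w in at z within S. f w < f z + h"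
    using f z \<open>h > 0\<close> by (simp add: usc_on_def)
  moreover have "\<forall>\<^sub>F w in at z within S. dist (g w) (g z) < h"
    using g z \<open>h > 0\<close> by (auto simp: continuous_on_def intro: tendstoD)
  ultimately show "\<forall>\<^sub>F w in at z within S. f w - g w < c"
  proof eventually_elim
    case (elim w)
    then show ?case by (simp add: h_def dist_real_def abs_real_def field_simps split: if_splits)
  qed
qed

text \<open>Without a maximum, every point of \<open>C\<close> has an open neighbourhood on which
  \<open>f\<close> stays below a single value \<open>f w\<close> with \<open>w \<in> C\<close>. A
  finite subcover leaves finitely many such values; the point realising the largest of them lies in
  one of the covering sets and is therefore beaten by another of these values.\<close>

lemma usc_on_attains_max:
  fixes f :: "'a::topological_space \<Rightarrow> real"
  assumes "compact C" "C \<noteq> {}" and usc: "usc_on C f"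
  shows "\<exists>m\<in>C. \<forall>w\<in>C. f w \<le> f m"
proof (rule ccontr)
  assume "\<not> ?thesis"
  then have no: "\<forall>m\<in>C. \<exists>w\<in>C. f m < f w" by (auto simp: not_le)
  have "\<exists>U. open U \<and> z \<in> U \<and> (\<exists>w\<in>C. \<forall>x\<in>U \<inter> C. f x < f w)" if z: "z \<in> C" for z
  proof -
    obtain w where w: "w \<in> C" "f z < f w" using no z by blast
    have "\<forall>\<^sub>F x in at z within C. f x < f w" using usc z w by (simp add: usc_on_def)
    then obtain U where "open U" "z \<in> U" "\<forall>x\<in>U. x \<noteq> z \<longrightarrow> x \<in> C \<longrightarrow> f x < f w"
      by (auto simp: eventually_at_topological)
    then show ?thesis using w by (intro exI[of _ U]) auto
  qed
  then obtain U where U: "\<And>z. z \<in> C \<Longrightarrow> open (U z) \<and> z \<in> U z \<and> (\<exists>w\<in>C. \<forall>x\<in>U z \<inter> C. f x < f w)"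
    by metis
  obtain D where D: "D \<subseteq> C" "finite D" "C \<subseteq> (\<Union>z\<in>D. U z)"
    using compactE_image[OF \<open>compact C\<close>, of C U] U by (metis UN_I subsetI)
  obtain W where W: "\<And>z. z \<in> C \<Longrightarrow> W z \<in> C \<and> (\<forall>x\<in>U z \<inter> C. f x < f (W z))"
    using U by metis
  have "D \<noteq> {}" using D \<open>C \<noteq> {}\<close> by auto
  define m where "m = Max ((\<lambda>z. f (W z)) ` D)"
  have "m \<in> (\<lambda>z. f (W z)) ` D" unfolding m_def using D \<open>D \<noteq> {}\<close> by (intro Max_in) auto
  then obtain z where z: "z \<in> D" "m = f (W z)" by auto
  then have "W z \<in> C" using W D by auto
  then obtain z' where z': "z' \<in> D" "W z \<in> U z'" using D by blast
  then have "m < f (W z')" using W[of z'] D z \<open>W z \<in> C\<close> by auto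
  moreover have "f (W z') \<le> m" unfolding m_def using D z' by (intro Max_ge) auto
  ultimately show False by simp
qed

section \<open>Semicontinuous envelopes at points of the set itself\<close>

lemma usc_on_tendsto_SUP:
  fixes u :: "'a::metric_space \<Rightarrow> real"
  assumes bdd: "bounded (u ` S)" and usc: "usc_on S u" and z: "z \<in> S"
  shows "((\<lambda>\<delta>. SUP w\<in>S \<inter> cball z \<delta>. u w) \<longlongrightarrow> u z) (at_right 0)"
proof (rule tendstoI)
    fix e :: real assume e: "e > 0"
    have "\<forall>\<^sub>F w in at z within S. u w < u z + e/2"
      using usc z e by (simp add: usc_on_def)
    then obtain d where d: "d > 0" "\<And>w. w \<in> S \<Longrightarrow> w \<noteq> z \<Longrightarrow> dist w z < d \<Longrightarrow> u w < u z + e/2"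
      by (auto simp: eventually_at)
    have "\<forall>\<^sub>F \<delta> in at_right (0::real). 0 < \<delta> \<and> \<delta> < d"
      using d by (auto simp: eventually_at_right_field)
    then show "\<forall>\<^sub>F \<delta> in at_right 0. dist (SUP w\<in>S \<inter> cball z \<delta>. u w) (u z) < e"
    proof eventually_elim
      case (elim \<delta>)
      have 1: "(SUP w\<in>S \<inter> cball z \<delta>. u w) \<le> u z + e/2"
      proof (rule cSUP_least)
        show "S \<inter> cball z \<delta> \<noteq> {}" using z elim by auto
        fix w assume "w \<in> S \<inter> cball z \<delta>"
        then show "u w \<le> u z + e/2"
          using d(2)[of w] elim e by (cases "w = z") (auto simp: dist_commute)
      qed
      \<comment> \<open>The point \<open>z\<close> belongs to every set over which the supremum is
        taken; this is where \<open>z \<in> S\<close> and boundedness enter.\<close>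
      have 2: "u z \<le> (SUP w\<in>S \<inter> cball z \<delta>. u w)"
      proof (rule cSUP_upper)
        show "z \<in> S \<inter> cball z \<delta>" using z elim by auto
        show "bdd_above (u ` (S \<inter> cball z \<delta>))"
          using bdd by (meson bounded_imp_bdd_above bdd_above_mono image_mono inf_le1)
      qed
      show ?case using 1 2 e by (auto simp: dist_real_def)
    qed
  qed

lemma upper_envelope_eq:
  fixes u :: "'a::metric_space \<Rightarrow> real"
  assumes "bounded (u ` S)" "usc_on S u" "z \<in> S"
  shows "upper_envelope S u z = u z"
  unfolding upper_envelope_def using usc_on_tendsto_SUP[OF assms] by (intro tendsto_Lim) auto

lemma usc_on_uminus_iff: "usc_on S (\<lambda>w. - u w) \<longleftrightarrow> lsc_on S u"
proof
  assume usc: "usc_on S (\<lambda>w. - u w)"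
  show "lsc_on S u"
    unfolding lsc_on_def
  proof (intro ballI allI impI)
    fix z a assume "z \<in> S" "a < u z"
    then have "\<forall>\<^sub>F w in at z within S. - u w < - a"
      using usc unfolding usc_on_def by (metis neg_less_iff_less)
    then show "\<forall>\<^sub>F w in at z within S. a < u w" by eventually_elim simp
  qed
next
  assume lsc: "lsc_on S u"
  show "usc_on S (\<lambda>w. - u w)"
    unfolding usc_on_def
  proof (intro ballI allI impI)
    fix z a assume "z \<in> S" "- u z < a"
    then have "\<forall>\<^sub>F w in at z within S. - a < u w"
      using lsc unfolding lsc_on_def by (metis minus_less_iff)
    then show "\<forall>\<^sub>F w in at z within S. - u w < a" by eventually_elim simp
  qed
qed

lemma lower_envelope_eq:
  fixes u :: "'a::metric_space \<Rightarrow> real"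
  assumes bdd: "bounded (u ` S)" and lsc: "lsc_on S u" and z: "z \<in> S"
  shows "lower_envelope S u z = u z"
proof -
  have "bounded ((\<lambda>w. - u w) ` S)"
    using bdd by (simp add: bounded_iff)
  then have "((\<lambda>\<delta>. SUP w\<in>S \<inter> cball z \<delta>. - u w) \<longlongrightarrow> - u z) (at_right 0)"
    using lsc z by (intro usc_on_tendsto_SUP) (simp_all add: usc_on_uminus_iff)
  \<comment> \<open>By \<open>Inf_real_def\<close> a real infimum is minus the supremum of the
    negatives, so the limit for \<open>- u\<close> is the required one up to sign.\<close>
  from tendsto_minus[OF this] show ?thesis
    unfolding lower_envelope_def Inf_real_def by (intro tendsto_Lim) (simp_all add: image_image)
qed

text \<open>Taking \<open>\<omega> d = (SUP s. \<bar>e s\<bar> * min 1 (d / s))\<close>, the map \<open>d \<mapsto> \<omega> d / d\<close> is decreasing, which makes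
  \<open>\<omega>\<close> locally Lipschitz away from \<open>0\<close>.\<close>

lemma modulus_of_continuity_majorant:
  fixes e :: "real \<Rightarrow> real"
  assumes e0: "(e \<longlongrightarrow> 0) (at_right 0)"
  shows "\<exists>\<omega>. modulus_of_continuity \<omega> \<and> (\<forall>\<^sub>F \<delta> in at_right 0. e \<delta> \<le> \<omega> \<delta>)"
proof -
  have small: "\<exists>b>0. \<forall>s. 0 < s \<and> s < b \<longrightarrow> \<bar>e s\<bar> < h" if "h > 0" for h
    using tendstoD[OF e0 that] by (auto simp: eventually_at_right_field)
  \<comment> \<open>Nothing is known about \<open>e\<close> away from 0. Restricting
    \<open>s\<close> to \<open>{0<..<b}\<close> keeps the supremum finite, in fact at most 1, and
    the majorant is claimed only for small arguments.\<close>
  obtain b where b: "b > 0" "\<And>s. 0 < s \<Longrightarrow> s < b \<Longrightarrow> \<bar>e s\<bar> < 1"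
    using small[of 1] by auto
  define k where "k d s = \<bar>e s\<bar> * min 1 (d / s)" for d s :: real
  define \<omega> where "\<omega> d = (SUP s\<in>{0<..<b}. k d s)" for d
  have ne: "{0<..<b} \<noteq> {}" using b by (auto intro: exI[of _ "b/2"])
  have k0: "0 \<le> k d s" if "0 \<le> d" "0 < s" for d s
    using that by (simp add: k_def)
  have k1: "k d s \<le> 1" if "s \<in> {0<..<b}" "0 \<le> d" for d s
  proof -
    have "k d s \<le> \<bar>e s\<bar> * 1" unfolding k_def by (intro mult_left_mono) auto
    then show ?thesis using b(2)[of s] that by simp
  qed
  have bdd: "bdd_above (k d ` {0<..<b})" if "0 \<le> d" for d
    using k1 that by (auto intro!: bdd_aboveI[of _ 1])
  have upper: "k d s \<le> \<omega> d" if "s \<in> {0<..<b}" "0 \<le> d" for d s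
    unfolding \<omega>_def using that bdd by (intro cSUP_upper)
  have least: "\<omega> d \<le> c" if "\<And>s. s \<in> {0<..<b} \<Longrightarrow> k d s \<le> c" for d c
    unfolding \<omega>_def using that ne by (intro cSUP_least)
  have nonneg: "0 \<le> \<omega> d" if "0 \<le> d" for d
    using upper[of "b/2" d] k0[of d "b/2"] that b by auto
  have le1: "\<omega> d \<le> 1" if "0 \<le> d" for d using least k1 that by blast
  have mono: "\<omega> d \<le> \<omega> d'" if "0 \<le> d" "d \<le> d'" for d d'
  proof (rule least)
    fix s assume s: "s \<in> {0<..<b}"
    have "k d s \<le> k d' s" unfolding k_def using s that
      by (intro mult_left_mono min.mono divide_right_mono) auto
    then show "k d s \<le> \<omega> d'" using upper[OF s, of d'] that by simp
  qed
  \<comment> \<open>This is the monotonicity of \<open>\<omega> d / d\<close>: multiplying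
    \<open>d\<close> by a factor at least 1 increases \<open>min 1 (d / s)\<close> by at most that
    factor. Together with \<open>mono\<close> and \<open>le1\<close> it yields the Lipschitz
    estimate \<open>lip\<close>.\<close>
  have scale: "\<omega> d' \<le> d' / d * \<omega> d" if "0 < d" "d \<le> d'" for d d'
  proof (rule least)
    fix s assume s: "s \<in> {0<..<b}"
    have "d' / d * min 1 (d / s) = min (d'/d) (d' / s)"
      using that by (simp add: min_mult_distrib_left)
    moreover have "1 \<le> d'/d" using that by simp
    ultimately have "min 1 (d'/s) \<le> d'/d * min 1 (d/s)" by auto
    then have "k d' s \<le> \<bar>e s\<bar> * (d'/d * min 1 (d/s))"
      unfolding k_def by (intro mult_left_mono) auto
    also have "\<dots> = d'/d * k d s" by (simp add: k_def)
    also have "\<dots> \<le> d'/d * \<omega> d" using upper[OF s, of d] that by (intro mult_left_mono) auto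
    finally show "k d' s \<le> d'/d * \<omega> d" .
  qed
  have lip: "\<bar>\<omega> d' - \<omega> d\<bar> \<le> (d' - d) / d" if "0 < d" "d \<le> d'" for d d'
  proof -
    have "\<omega> d' - \<omega> d \<le> (d'/d - 1) * \<omega> d" using scale[OF that] by (simp add: algebra_simps)
    also have "\<dots> \<le> (d'/d - 1) * 1" using that le1[of d] by (intro mult_left_mono) auto
    also have "\<dots> = (d' - d)/d" using that by (simp add: field_simps)
    finally show ?thesis using mono[of d d'] that by simp
  qed
  have zero: "\<omega> 0 = 0"
    using least[of 0 0] nonneg[of 0] by (auto simp: k_def)
  \<comment> \<open>The supremum is split at \<open>\<sigma>\<close>: for
    \<open>s < \<sigma>\<close> the factor \<open>\<bar>e s\<bar>\<close> is small, and for
    \<open>s \<ge> \<sigma>\<close> the factor \<open>d / s \<le> d / \<sigma>\<close> is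
    small.\<close>
  have cont0: "\<exists>h>0. \<forall>d. 0 \<le> d \<and> d < h \<longrightarrow> \<omega> d < \<epsilon>" if "\<epsilon> > 0" for \<epsilon>
  proof -
    have "0 < \<epsilon>/2" using that by simp
    from small[OF this]
    obtain \<sigma> where \<sigma>: "\<sigma> > 0" "\<And>s. 0 < s \<Longrightarrow> s < \<sigma> \<Longrightarrow> \<bar>e s\<bar> < \<epsilon>/2"
      by blast
    have "\<omega> d < \<epsilon>" if d: "0 \<le> d" "d < \<sigma> * (\<epsilon>/2)" for d
    proof -
      have "\<omega> d \<le> \<epsilon>/2"
      proof (rule least)
        fix s assume s: "s \<in> {0<..<b}"
        show "k d s \<le> \<epsilon>/2"
        proof (cases "s < \<sigma>")
          case True
          have "k d s \<le> \<bar>e s\<bar> * 1" unfolding k_def by (intro mult_left_mono) auto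
          then show ?thesis using \<sigma>(2)[of s] s True by simp
        next
          case False
          have "k d s \<le> 1 * (d / s)" unfolding k_def using b(2)[of s] s d
            by (intro mult_mono) auto
          also have "\<dots> \<le> d / \<sigma>" using False \<sigma> d by (auto intro: divide_left_mono)
          also have "\<dots> \<le> \<epsilon>/2" using \<sigma> d by (simp add: field_simps)
          finally show ?thesis .
        qed
      qed
      then show ?thesis using \<open>\<epsilon> > 0\<close> by simp
    qed
    then show ?thesis using \<sigma> that by (intro exI[of _ "\<sigma> * (\<epsilon>/2)"]) auto
  qed
  have "continuous_on {0..} \<omega>"
    unfolding continuous_on_iff
  proof (intro ballI allI impI)
    fix d \<epsilon> :: real assume d: "d \<in> {0..}" and \<epsilon>: "\<epsilon> > 0"
    show "\<exists>h>0. \<forall>d'\<in>{0..}. dist d' d < h \<longrightarrow> dist (\<omega> d') (\<omega> d) < \<epsilon>"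
    proof (cases "d = 0")
      case True
      then show ?thesis using cont0[OF \<epsilon>] zero nonneg by (auto simp: dist_real_def)
    next
      case False
      then have d: "d > 0" using d by simp
      define h where "h = min (d/2) (\<epsilon> * d / 4)"
      have "dist (\<omega> d') (\<omega> d) < \<epsilon>" if d': "dist d' d < h" for d'
      proof -
        define m where "m = min d d'"
        have near: "\<bar>d' - d\<bar> < d/2" "\<bar>d' - d\<bar> < \<epsilon> * d / 4"
          using d' by (simp_all add: h_def dist_real_def)
        then have "m \<ge> d/2" unfolding m_def using d by (simp add: min_def abs_if split: if_splits)
        have "dist (\<omega> d') (\<omega> d) \<le> \<bar>d' - d\<bar> / m"
          using lip[of d d'] lip[of d' d] \<open>m \<ge> d/2\<close> d by (auto simp: dist_real_def m_def min_def)
        also have "\<dots> \<le> \<bar>d' - d\<bar> / (d/2)"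
          using \<open>m \<ge> d/2\<close> d by (intro divide_left_mono) auto
        also have "\<dots> < \<epsilon>" using near mult_pos_pos[OF \<epsilon> d] d by (simp add: field_simps)
        finally show ?thesis .
      qed
      then show ?thesis using d \<epsilon> by (intro exI[of _ h]) (auto simp: h_def)
    qed
  qed
  then have "modulus_of_continuity \<omega>"
    unfolding modulus_of_continuity_def using mono nonneg zero by (auto intro: mono_onI)
  moreover have "\<forall>\<^sub>F \<delta> in at_right 0. e \<delta> \<le> \<omega> \<delta>"
  proof -
    \<comment> \<open>Choosing \<open>s = d\<close> in the supremum makes the factor
      \<open>min 1 (d / s)\<close> equal to 1.\<close>
    have "e d \<le> \<omega> d" if "0 < d" "d < b" for d
      using upper[of d d] that by (simp add: k_def)
    then show ?thesis using b by (auto simp: eventually_at_right_field)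
  qed
  ultimately show ?thesis by blast
qed

section \<open>Quadratic test functions\<close>

lemma gradient_eq:
  assumes "GDERIV f x :> D"
  shows "gradient f x = D"
  unfolding gradient_def
proof (rule the_equality)
  fix D' assume "GDERIV f x :> D'"
  then have "(\<lambda>h. h \<bullet> D') = (\<lambda>h. h \<bullet> D)"
    using assms unfolding gderiv_def by (rule has_derivative_unique)
  then show "D' = D" by (metis inner_commute vector_eq_rdot)
qed (rule assms)

lemma gradient_quadratic:
  fixes a :: "real^'n"
  shows "gradient (\<lambda>x. b + k * (norm (x - a))\<^sup>2) y = (2 * k) *\<^sub>R (y - a)"
proof (rule gradient_eq)
  show "GDERIV (\<lambda>x. b + k * (norm (x - a))\<^sup>2) y :> (2 * k) *\<^sub>R (y - a)"
    unfolding gderiv_def power2_norm_eq_inner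
    by (auto intro!: derivative_eq_intros simp: inner_commute algebra_simps)
qed

lemma hessian_quadratic:
  fixes a :: "real^'n"
  shows "hessian (\<lambda>x. b + k * (norm (x - a))\<^sup>2) y = (2 * k) *\<^sub>R mat 1"
proof -
  have "((\<lambda>x. (2 * k) *\<^sub>R (x - a)) has_derivative (\<lambda>h. (2 * k) *\<^sub>R h)) (at y)"
    by (auto intro!: derivative_eq_intros)
  then have "frechet_derivative (\<lambda>x. (2 * k) *\<^sub>R (x - a)) (at y) = (\<lambda>h. (2 * k) *\<^sub>R h)"
    by (rule frechet_derivative_at[symmetric])
  then have "jacobian (\<lambda>x. (2 * k) *\<^sub>R (x - a)) (at y) = mat (2 * k)"
    unfolding jacobian_def by (simp add: matrix_scaleR)
  also have "mat (2 * k) = (2 * k) *\<^sub>R (mat 1 :: real^'n^'n)"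
    by (simp add: mat_def vec_eq_iff)
  finally show ?thesis unfolding hessian_def gradient_quadratic .
qed

text \<open>The test functions of the boundary argument are a function of time plus a paraboloid in
  space, so this class is all that has to be shown admissible. The derivatives are exhibited as
  bounded linear maps, as \<open>C2_up_to\<close> demands.\<close>

lemma C2_up_to_quadratic:
  fixes a :: "real^'n" and g g' g'' :: "real \<Rightarrow> real"
  assumes g: "\<And>t. t \<in> I \<Longrightarrow> (g has_real_derivative g' t) (at t)"
    and g': "\<And>t. t \<in> I \<Longrightarrow> (g' has_real_derivative g'' t) (at t)"
    and g'': "continuous_on I g''"
  shows "C2_up_to (S \<times> I) (S \<times> I) (\<lambda>(x, t). g t + k * (norm (x - a))\<^sup>2)"
proof -
  \<comment> \<open>\<open>q\<close> is the bilinear form pairing the space components by the inner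
    product. The squared distance to \<open>a\<close> has first derivative
    \<open>2 * q (w - (a, 0))\<close> and constant second derivative \<open>2 * q\<close>.\<close>
  define q :: "((real^'n) \<times> real) \<Rightarrow>\<^sub>L (((real^'n) \<times> real) \<Rightarrow>\<^sub>L real)"
    where "q = Blinfun (\<lambda>w. blinfun_inner_left (fst w) o\<^sub>L fst_blinfun)"
  have q: "blinfun_apply q = (\<lambda>w. blinfun_inner_left (fst w) o\<^sub>L fst_blinfun)"
    unfolding q_def
    by (rule bounded_linear_Blinfun_apply)
      (intro bounded_linear_intros bounded_linear_compose[OF bounded_linear_blinfun_inner_left])
  define s :: "((real^'n) \<times> real) \<Rightarrow>\<^sub>L real" where "s = snd_blinfun"
  define f' where "f' w = g' (snd w) *\<^sub>R s + (2 * k) *\<^sub>R blinfun_apply q (w - (a, 0))" for w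
  define f'' where "f'' w = g'' (snd w) *\<^sub>R (blinfun_scaleR_left s o\<^sub>L snd_blinfun) + (2 * k) *\<^sub>R q"
    for w :: "(real^'n) \<times> real"
  have d1: "((\<lambda>(x, t). g t + k * (norm (x - a))\<^sup>2) has_derivative blinfun_apply (f' w)) (at w)"
    if "w \<in> S \<times> I" for w
  proof -
    have "((\<lambda>v. g (snd v)) has_derivative (\<lambda>h. g' (snd w) * snd h)) (at w)"
      using has_derivative_compose[OF has_derivative_snd[OF has_derivative_ident]
        g[of "snd w", unfolded has_field_derivative_def]] that by auto
    then have "((\<lambda>v. g (snd v) + k * ((fst v - a) \<bullet> (fst v - a))) has_derivative blinfun_apply (f' w)) (at w)"
      by (auto intro!: derivative_eq_intros
        simp: f'_def q s_def blinfun.bilinear_simps inner_commute algebra_simps fun_eq_iff)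
    then show ?thesis by (simp add: power2_norm_eq_inner case_prod_beta')
  qed
  have d2: "(f' has_derivative blinfun_apply (f'' w)) (at w)" if "w \<in> S \<times> I" for w
  proof -
    have "((\<lambda>v. g' (snd v)) has_derivative (\<lambda>h. g'' (snd w) * snd h)) (at w)"
      using has_derivative_compose[OF has_derivative_snd[OF has_derivative_ident]
        g'[of "snd w", unfolded has_field_derivative_def]] that by auto
    moreover have "((\<lambda>v. blinfun_apply q (v - (a, 0))) has_derivative blinfun_apply q) (at w)"
      by (auto intro!: derivative_eq_intros)
    ultimately show ?thesis
      unfolding f'_def[abs_def] f''_def
      by (auto intro!: derivative_eq_intros simp: blinfun.bilinear_simps fun_eq_iff)
  qed
  have c0: "continuous_on (S \<times> I) (\<lambda>(x, t). g t + k * (norm (x - a))\<^sup>2)"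
    using d1 by (meson continuous_at_imp_continuous_on has_derivative_continuous)
  have c1: "continuous_on (S \<times> I) f'"
    using d2 by (meson continuous_at_imp_continuous_on has_derivative_continuous)
  have "continuous_on (S \<times> I) (\<lambda>w. g'' (snd w))"
    by (rule continuous_on_compose2[OF g'' continuous_on_snd[OF continuous_on_id]]) auto
  then have c2: "continuous_on (S \<times> I) f''"
    unfolding f''_def[abs_def] by (intro continuous_intros)
  show ?thesis
    unfolding C2_up_to_def using d1 d2 c0 c1 c2 by blast
qed

lemma time_deriv_quadratic:
  assumes "(g has_real_derivative g') (at s)"
  shows "time_deriv (\<lambda>(x, t). g t + k * (norm (x - a))\<^sup>2) (y, s) = g'"
proof -
  have "((\<lambda>t. g t + k * (norm (y - a))\<^sup>2) has_real_derivative g') (at s)"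
    using assms by (auto intro!: derivative_eq_intros)
  then show ?thesis unfolding time_deriv_def by (simp add: DERIV_imp_deriv)
qed

lemma space_gradient_quadratic:
  "space_gradient (\<lambda>(x, t). g t + k * (norm (x - a))\<^sup>2) (y, s) = (2 * k) *\<^sub>R (y - a)"
  by (simp add: space_gradient_def gradient_quadratic)

lemma space_hessian_quadratic:
  "space_hessian (\<lambda>(x, t). g t + k * (norm (x - a))\<^sup>2) (y, s) = (2 * k) *\<^sub>R mat 1"
  by (simp add: space_hessian_def hessian_quadratic)

lemma visc_subsolution_quadratic:
  fixes a :: "real^'n" and g g' g'' :: "real \<Rightarrow> real"
  assumes "visc_subsolution \<Omega> T H u"
    and "\<And>t. t \<in> {0<..<T} \<Longrightarrow> (g has_real_derivative g' t) (at t)"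
    and "\<And>t. t \<in> {0<..<T} \<Longrightarrow> (g' has_real_derivative g'' t) (at t)"
    and "continuous_on {0<..<T} g''"
    and "(y, s) \<in> \<Omega> \<times> {0<..<T}"
    and "local_max_on (\<Omega> \<times> {0<..<T}) (\<lambda>(x, t). u (x, t) - (g t + k * (norm (x - a))\<^sup>2)) (y, s)"
  shows "g' s + H y (u (y, s)) ((2 * k) *\<^sub>R (y - a)) ((2 * k) *\<^sub>R mat 1) \<le> 0"
proof -
  let ?\<phi> = "\<lambda>(x, t). g t + k * (norm (x - a))\<^sup>2"
  have "C2_up_to (\<Omega> \<times> {0<..<T}) (\<Omega> \<times> {0<..<T}) ?\<phi>"
    using assms(2-4) by (rule C2_up_to_quadratic)
  moreover have "local_max_on (\<Omega> \<times> {0<..<T}) (\<lambda>w. u w - ?\<phi> w) (y, s)"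
    using assms(6) by (simp add: case_prod_beta')
  ultimately have "time_deriv ?\<phi> (y, s)
      + H y (u (y, s)) (space_gradient ?\<phi> (y, s)) (space_hessian ?\<phi> (y, s)) \<le> 0"
    using assms(1,5) unfolding visc_subsolution_def Let_def by blast
  moreover have "time_deriv ?\<phi> (y, s) = g' s"
    using assms(2,5) by (intro time_deriv_quadratic) auto
  ultimately show ?thesis
    by (simp only: space_gradient_quadratic space_hessian_quadratic)
qed

lemma visc_supersolution_quadratic:
  fixes a :: "real^'n" and g g' g'' :: "real \<Rightarrow> real"
  assumes "visc_supersolution \<Omega> T H u"
    and "\<And>t. t \<in> {0<..<T} \<Longrightarrow> (g has_real_derivative g' t) (at t)"
    and "\<And>t. t \<in> {0<..<T} \<Longrightarrow> (g' has_real_derivative g'' t) (at t)"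
    and "continuous_on {0<..<T} g''"
    and "(y, s) \<in> \<Omega> \<times> {0<..<T}"
    and "local_min_on (\<Omega> \<times> {0<..<T}) (\<lambda>(x, t). u (x, t) - (g t + k * (norm (x - a))\<^sup>2)) (y, s)"
  shows "g' s + H y (u (y, s)) ((2 * k) *\<^sub>R (y - a)) ((2 * k) *\<^sub>R mat 1) \<ge> 0"
proof -
  let ?\<phi> = "\<lambda>(x, t). g t + k * (norm (x - a))\<^sup>2"
  have "C2_up_to (\<Omega> \<times> {0<..<T}) (\<Omega> \<times> {0<..<T}) ?\<phi>"
    using assms(2-4) by (rule C2_up_to_quadratic)
  moreover have "local_min_on (\<Omega> \<times> {0<..<T}) (\<lambda>w. u w - ?\<phi> w) (y, s)"
    using assms(6) by (simp add: case_prod_beta')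
  ultimately have "time_deriv ?\<phi> (y, s)
      + H y (u (y, s)) (space_gradient ?\<phi> (y, s)) (space_hessian ?\<phi> (y, s)) \<ge> 0"
    using assms(1,5) unfolding visc_supersolution_def Let_def by blast
  moreover have "time_deriv ?\<phi> (y, s) = g' s"
    using assms(2,5) by (intro time_deriv_quadratic) auto
  ultimately show ?thesis
    by (simp only: space_gradient_quadratic space_hessian_quadratic)
qed

section \<open>The inequality at the boundary\<close>

lemma has_real_derivative_slice:
  assumes "(\<phi> has_derivative F) (at (x, t))"
  shows "((\<lambda>t. \<phi> (x, t)) has_real_derivative F (0, 1)) (at t)"
proof -
  have "((\<lambda>t. (x, t)) has_derivative (\<lambda>h. (0, h))) (at t)"
    by (auto intro!: derivative_eq_intros)
  from has_derivative_compose[OF this assms]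
  have "((\<lambda>t. \<phi> (x, t)) has_derivative (\<lambda>h. F (0, h))) (at t)" .
  also have "(\<lambda>h. F (0, h)) = (*) (F (0, 1))"
  proof
    fix h :: real
    show "F (0, h) = F (0, 1) * h"
      using linear_scale[OF has_derivative_linear[OF assms], of h "(0, 1)"] by simp
  qed
  finally show ?thesis unfolding has_field_derivative_def .
qed

lemma norm_Pair_0_1: "norm (0 :: 'a::real_normed_vector, 1 :: real) = 1"
  by (simp add: norm_Pair)

text \<open>On the lateral boundary \<open>f'\<close> is only a continuous extension, so it must be
  shown that its time component is a genuine derivative there. The mean value estimate on vertical
  segments over interior points \<open>X n\<close> holds with a constant independent of
  \<open>n\<close>, and hence survives the passage \<open>X n\<close> to \<open>x0\<close>.\<close>

lemma has_time_derivative_up_to_boundary: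
  fixes \<Omega> :: "(real^'n) set"
  assumes der: "\<And>w. w \<in> \<Omega> \<times> I \<Longrightarrow> (\<phi> has_derivative blinfun_apply (f' w)) (at w)"
    and cont: "continuous_on (closure \<Omega> \<times> I) \<phi>" "continuous_on (closure \<Omega> \<times> I) f'"
    and I: "open I" "t0 \<in> I" and x0: "x0 \<in> closure \<Omega>"
  shows "((\<lambda>t. \<phi> (x0, t)) has_real_derivative blinfun_apply (f' (x0, t0)) (0, 1)) (at t0)"
proof -
  let ?D = "blinfun_apply (f' (x0, t0)) (0, 1)"
  obtain X where X: "\<And>n. X n \<in> \<Omega>" "X \<longlonglongrightarrow> x0"
    using x0 by (auto simp: closure_sequential)
  have conv: "(\<lambda>n. \<phi> (X n, t)) \<longlonglongrightarrow> \<phi> (x0, t)" if "t \<in> I" for t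
    using cont(1) X x0 that closure_subset
    by (intro continuous_on_tendsto_compose[OF cont(1)] tendsto_intros always_eventually) auto
  have "((\<lambda>t. (\<phi> (x0, t) - \<phi> (x0, t0)) / (t - t0)) \<longlongrightarrow> ?D) (at t0)"
  proof (rule tendstoI)
    fix \<epsilon> :: real assume \<epsilon>: "\<epsilon> > 0"
    obtain \<rho>1 where \<rho>1: "\<rho>1 > 0"
      "\<And>w. w \<in> closure \<Omega> \<times> I \<Longrightarrow> dist w (x0, t0) < \<rho>1 \<Longrightarrow> dist (f' w) (f' (x0, t0)) < \<epsilon>/2"
      using cont(2) x0 I \<epsilon> unfolding continuous_on_iff by (metis half_gt_zero mem_Times_iff fst_conv snd_conv)
    obtain \<rho>2 where \<rho>2: "\<rho>2 > 0" "ball t0 \<rho>2 \<subseteq> I" using I by (meson openE)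
    \<comment> \<open>Half of \<open>\<rho>1\<close> is spent on the time distance and the other
      half on the distance of \<open>X n\<close> to \<open>x0\<close>; \<open>\<rho>2\<close> keeps
      the segment inside \<open>I\<close>.\<close>
    define \<rho> where "\<rho> = min (\<rho>1/2) \<rho>2"
    have \<rho>: "\<rho> > 0" using \<rho>1 \<rho>2 by (simp add: \<rho>_def)
    have bound: "\<bar>\<phi> (x0, t) - \<phi> (x0, t0) - ?D * (t - t0)\<bar> \<le> \<epsilon>/2 * \<bar>t - t0\<bar>" if t: "dist t t0 < \<rho>" for t
    proof (rule tendsto_upperbound)
      have "t \<in> I" using t \<rho>2 by (auto simp: \<rho>_def dist_commute subset_iff)
      then show "(\<lambda>n. \<bar>\<phi> (X n, t) - \<phi> (X n, t0) - ?D * (t - t0)\<bar>)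
          \<longlonglongrightarrow> \<bar>\<phi> (x0, t) - \<phi> (x0, t0) - ?D * (t - t0)\<bar>"
        using conv I by (intro tendsto_intros) auto
      have "\<forall>\<^sub>F n in sequentially. dist (X n) x0 < \<rho>1/2"
        using X \<rho>1 by (intro tendstoD) auto
      then show "\<forall>\<^sub>F n in sequentially. \<bar>\<phi> (X n, t) - \<phi> (X n, t0) - ?D * (t - t0)\<bar> \<le> \<epsilon>/2 * \<bar>t - t0\<bar>"
      proof eventually_elim
        case (elim n)
        \<comment> \<open>Subtracting the linear function \<open>?D * t\<close> reduces the claim to
          the mean value inequality for a function whose derivative is at most
          \<open>\<epsilon>/2\<close> in absolute value.\<close>
        have "norm ((\<phi> (X n, t) - ?D * t) - (\<phi> (X n, t0) - ?D * t0)) \<le> \<epsilon>/2 * norm (t - t0)"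
        proof (rule field_differentiable_bound[where S = "ball t0 \<rho>"
              and f' = "\<lambda>r. blinfun_apply (f' (X n, r)) (0, 1) - ?D"])
          show "convex (ball t0 \<rho>)" by simp
          show "t \<in> ball t0 \<rho>" "t0 \<in> ball t0 \<rho>" using t \<rho> by (auto simp: dist_commute)
          fix r assume r: "r \<in> ball t0 \<rho>"
          then have rI: "r \<in> I" using \<rho>2 by (auto simp: \<rho>_def subset_iff)
          show "((\<lambda>t. \<phi> (X n, t) - ?D * t) has_field_derivative
              blinfun_apply (f' (X n, r)) (0, 1) - ?D) (at r within ball t0 \<rho>)"
            by (rule has_field_derivative_at_within)
              (auto intro!: derivative_eq_intros has_real_derivative_slice der X rI)
          have "dist (X n, r) (x0, t0) \<le> dist (X n) x0 + dist r t0"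
            unfolding dist_Pair_Pair by (rule sqrt_sum_squares_le_sum) auto
          also have "\<dots> < \<rho>1" using elim r by (auto simp: \<rho>_def dist_commute)
          finally have "norm (f' (X n, r) - f' (x0, t0)) < \<epsilon>/2"
            using \<rho>1(2)[of "(X n, r)"] X(1)[of n] closure_subset rI by (auto simp: dist_norm)
          then show "norm (blinfun_apply (f' (X n, r)) (0, 1) - ?D) \<le> \<epsilon>/2"
            using norm_blinfun[of "f' (X n, r) - f' (x0, t0)" "(0, 1)"]
            by (simp add: blinfun.diff_left norm_Pair_0_1)
        qed
        then show ?case by (simp add: algebra_simps)
      qed
    qed simp
    have "\<forall>\<^sub>F t in at t0. t \<noteq> t0 \<and> dist t t0 < \<rho>"
      using \<rho> by (auto simp: eventually_at)
    then show "\<forall>\<^sub>F t in at t0. dist ((\<phi> (x0, t) - \<phi> (x0, t0)) / (t - t0)) ?D < \<epsilon>"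
    proof eventually_elim
      case (elim t)
      have "(\<phi> (x0, t) - \<phi> (x0, t0)) / (t - t0) - ?D = (\<phi> (x0, t) - \<phi> (x0, t0) - ?D * (t - t0)) / (t - t0)"
        using elim by (simp add: field_simps)
      then have "dist ((\<phi> (x0, t) - \<phi> (x0, t0)) / (t - t0)) ?D
          = \<bar>\<phi> (x0, t) - \<phi> (x0, t0) - ?D * (t - t0)\<bar> / \<bar>t - t0\<bar>"
        by (simp add: dist_real_def)
      also have "\<dots> \<le> \<epsilon>/2" using bound[of t] elim by (simp add: pos_divide_le_eq)
      finally show ?case using \<epsilon> by simp
    qed
  qed
  then show ?thesis by (simp add: has_field_derivative_iff)
qed

text \<open>The assumption \<open>test\<close> is the subsolution property for test functions that are quadratic in space.
  In this form it is also available for \<open>- u\<close> when \<open>u\<close> is a supersolution.\<close>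

lemma boundary_viscosity_inequality:
  fixes \<Omega> :: "(real^'n) set" and \<mu> x0 :: "real^'n" and T t0 d0 a :: real
    and u v \<phi> :: "(real^'n) \<times> real \<Rightarrow> real" and G0 :: "real \<Rightarrow> real"
    and H :: "real^'n \<Rightarrow> real \<Rightarrow> real^'n \<Rightarrow> real^'n^'n \<Rightarrow> real"
  defines "\<Omega>T \<equiv> \<Omega> \<times> {0<..<T}" and "QT \<equiv> closure \<Omega> \<times> {0<..<T}"
  assumes t0: "0 < t0" "t0 < T"
    and inner: "d0 > 0" "a > 0" "norm \<mu> + a \<le> 1"
      "\<And>\<delta>. 0 < \<delta> \<Longrightarrow> \<delta> < d0 \<Longrightarrow> cball (x0 + \<delta> *\<^sub>R \<mu>) (a * \<delta>) \<subseteq> \<Omega>"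
    and G0: "continuous_on UNIV G0"
    and sing: "\<And>\<omega> \<epsilon>. modulus_of_continuity \<omega> \<Longrightarrow> \<epsilon> > 0 \<Longrightarrow>
      \<forall>\<^sub>F \<delta> in at_right 0. \<forall>x r p X. x \<in> \<Omega> \<longrightarrow> norm (x - x0) \<le> \<delta> \<longrightarrow> norm p \<le> \<omega> \<delta> / \<delta> \<longrightarrow>
         X \<in> sym_matrices \<longrightarrow> norm X \<le> \<omega> \<delta> / \<delta>\<^sup>2 \<longrightarrow> \<bar>H x r p X - G0 r\<bar> \<le> \<epsilon>"
    and usc: "usc_on \<Omega>T u"
    and test: "\<And>g g' g'' k b y s.
      (\<And>t. t \<in> {0<..<T} \<Longrightarrow> (g has_real_derivative g' t) (at t)) \<Longrightarrow>
      (\<And>t. t \<in> {0<..<T} \<Longrightarrow> (g' has_real_derivative g'' t) (at t)) \<Longrightarrow>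
      continuous_on {0<..<T} g'' \<Longrightarrow> (y, s) \<in> \<Omega>T \<Longrightarrow>
      local_max_on \<Omega>T (\<lambda>(x, t). u (x, t) - (g t + k * (norm (x - b))\<^sup>2)) (y, s) \<Longrightarrow>
      g' s + H y (u (y, s)) ((2 * k) *\<^sub>R (y - b)) ((2 * k) *\<^sub>R mat 1) \<le> 0"
    and eq: "\<And>w. w \<in> \<Omega>T \<Longrightarrow> v w = u w"
    and v: "continuous (at (x0, t0) within QT) v"
    and C2: "C2_up_to \<Omega>T QT \<phi>"
    and max: "local_max_on QT (\<lambda>w. v w - \<phi> w) (x0, t0)"
  shows "time_deriv \<phi> (x0, t0) + G0 (v (x0, t0)) \<le> 0"
proof (rule ccontr)
  define z0 where "z0 = (x0, t0)"
  obtain f' f'' where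
    der: "\<And>w. w \<in> \<Omega>T \<Longrightarrow> (\<phi> has_derivative blinfun_apply (f' w)) (at w)"
      "\<And>w. w \<in> \<Omega>T \<Longrightarrow> (f' has_derivative blinfun_apply (f'' w)) (at w)"
    and cont: "continuous_on QT \<phi>" "continuous_on QT f'" "continuous_on QT f''"
    using C2 unfolding C2_up_to_def by blast
  have z0: "z0 \<in> QT" using max by (simp add: local_max_on_def z0_def)
  have sub: "\<Omega>T \<subseteq> QT" unfolding \<Omega>T_def QT_def using closure_subset by auto
  define D where "D = blinfun_apply (f' z0) (0, 1)"
  have "((\<lambda>t. \<phi> (x0, t)) has_real_derivative D) (at t0)"
    unfolding D_def z0_def
    using der(1) cont z0 unfolding \<Omega>T_def QT_def z0_def
    by (intro has_time_derivative_up_to_boundary) auto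
  then have D: "time_deriv \<phi> (x0, t0) = D"
    by (simp add: time_deriv_def DERIV_imp_deriv)
  assume "\<not> ?thesis"
  then have pos: "D + G0 (v z0) > 0" by (simp add: D z0_def)
  \<comment> \<open>The errors collected below add up to \<open>4 * \<epsilon>\<close>: one from
    replacing \<open>H\<close> by \<open>G0\<close>, one from the continuity of \<open>G0\<close>
    along \<open>v\<close>, and two from \<open>g'\<close>. Any divisor above 4 would give the
    contradiction.\<close>
  define \<epsilon> where "\<epsilon> = (D + G0 (v z0)) / 6"
  have \<epsilon>: "\<epsilon> > 0" using pos by (simp add: \<epsilon>_def)
  define M where "M = v z0 - \<phi> z0"
  \<comment> \<open>\<open>L\<close> bounds the norm of \<open>f' w\<close> wherever
    \<open>f' w\<close> is within \<open>\<epsilon>\<close> of \<open>f' z0\<close>, so it is a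
    Lipschitz constant for \<open>\<phi>\<close> on the small cylinder \<open>C\<close>.\<close>
  define L where "L = norm (f' z0) + \<epsilon>"
  have L: "L > 0" unfolding L_def using \<epsilon> norm_ge_zero[of "f' z0"] by linarith
  have tv: "(v \<longlongrightarrow> v z0) (at z0 within QT)"
    using v by (simp add: continuous_within z0_def)
  have "isCont G0 (v z0)" using G0 by (simp add: continuous_on_eq_continuous_at)
  then have "\<forall>\<^sub>F w in at z0 within QT. dist (G0 (v w)) (G0 (v z0)) < \<epsilon>"
    using isCont_tendsto_compose[OF _ tv] \<epsilon> by (intro tendstoD) auto
  moreover have "\<forall>\<^sub>F w in at z0 within QT. dist (f' w) (f' z0) < \<epsilon>"
    using cont(2) z0 \<epsilon> by (intro tendstoD) (auto simp: continuous_on_def)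
  moreover have "\<forall>\<^sub>F w in at z0 within QT. v w - \<phi> w \<le> M"
    using max by (simp add: local_max_on_def M_def z0_def)
  ultimately have "\<forall>\<^sub>F w in at z0 within QT. dist (G0 (v w)) (G0 (v z0)) < \<epsilon>
      \<and> dist (f' w) (f' z0) < \<epsilon> \<and> v w - \<phi> w \<le> M"
    by eventually_elim auto
  then obtain \<rho>1 where \<rho>1: "\<rho>1 > 0"
    and "\<And>w. w \<in> QT \<Longrightarrow> w \<noteq> z0 \<Longrightarrow> dist w z0 < \<rho>1 \<Longrightarrow> dist (G0 (v w)) (G0 (v z0)) < \<epsilon>
      \<and> dist (f' w) (f' z0) < \<epsilon> \<and> v w - \<phi> w \<le> M"
    by (auto simp: eventually_at)
  then have near1: "dist (G0 (v w)) (G0 (v z0)) < \<epsilon> \<and> dist (f' w) (f' z0) < \<epsilon> \<and> v w - \<phi> w \<le> M"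
    if "w \<in> QT" "dist w z0 < \<rho>1" for w
    using that \<epsilon> by (cases "w = z0") (auto simp: M_def)
  define \<rho> where "\<rho> = Min {\<rho>1, t0, T - t0}"
  have \<rho>: "\<rho> > 0" "\<rho> \<le> \<rho>1" "\<rho> \<le> t0" "\<rho> \<le> T - t0" using \<rho>1 t0 by (auto simp: \<rho>_def)
  \<comment> \<open>The bound \<open>\<rho>/2\<close>, together with
    \<open>\<delta> < \<rho>/2\<close>, keeps the cylinder close to \<open>z0\<close> and inside the
    time interval. The bound \<open>\<epsilon>/2\<close> makes the derivative of the time penalty,
    \<open>2 * (s - t0)\<close>, at most \<open>\<epsilon>\<close> in absolute value.\<close>
  define \<eta> where "\<eta> = min (\<rho>/2) (\<epsilon>/2)"
  have \<eta>: "\<eta> > 0" "\<eta> \<le> \<rho>/2" "\<eta> \<le> \<epsilon>/2" using \<rho> \<epsilon> by (auto simp: \<eta>_def)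
  define X0 where "X0 \<delta> = x0 + \<delta> *\<^sub>R \<mu>" for \<delta> :: real
  \<comment> \<open>\<open>e \<delta>\<close> measures how far \<open>v - \<phi>\<close> at the
    centre of the cylinder is from its value \<open>M\<close> at \<open>z0\<close>; it tends to 0
    because \<open>v\<close> is continuous at \<open>z0\<close>. In \<open>E\<close>, the term
    \<open>L * \<delta>\<close> pays for freezing the space variable of \<open>\<phi>\<close>, and
    the spare \<open>\<delta>\<close> makes the final comparison strict and
    \<open>E \<delta>\<close> positive.\<close>
  define e where "e \<delta> = \<bar>v (X0 \<delta>, t0) - \<phi> (X0 \<delta>, t0) - M\<bar>" for \<delta>
  define E where "E \<delta> = L * \<delta> + e \<delta> + \<delta>" for \<delta>
  have X0: "X0 \<delta> \<in> \<Omega>" if "0 < \<delta>" "\<delta> < d0" for \<delta>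
    using inner(4)[OF that] inner(2) that by (auto simp: X0_def subset_iff)
  have "\<forall>\<^sub>F \<delta> in at_right (0::real). 0 < \<delta> \<and> \<delta> < d0"
    using inner(1) by (auto simp: eventually_at_right_field)
  then have "\<forall>\<^sub>F \<delta> in at_right 0. (X0 \<delta>, t0) \<in> QT"
    by eventually_elim (use X0 sub t0 \<Omega>T_def in auto)
  moreover have "((\<lambda>\<delta>. (X0 \<delta>, t0)) \<longlongrightarrow> z0) (at_right 0)"
    unfolding X0_def z0_def by (auto intro!: tendsto_eq_intros)
  moreover have "continuous (at z0 within QT) (\<lambda>w. v w - \<phi> w)"
    using v cont(1) z0 by (auto simp: z0_def continuous_on_eq_continuous_within intro!: continuous_intros)
  ultimately have "((\<lambda>\<delta>. v (X0 \<delta>, t0) - \<phi> (X0 \<delta>, t0)) \<longlongrightarrow> M) (at_right 0)"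
    unfolding M_def by (rule continuous_within_tendsto_compose[rotated])
  then have "(e \<longlongrightarrow> 0) (at_right 0)"
    unfolding e_def[abs_def] by (intro tendsto_rabs_zero LIM_zero)
  then have E0: "(E \<longlongrightarrow> 0) (at_right 0)"
    unfolding E_def[abs_def] by (auto intro!: tendsto_eq_intros)
  \<comment> \<open>With \<open>k = E \<delta> / (a * \<delta>)\<^sup>2\<close>, the gradient
    \<open>2 * k * (y - \<xi>)\<close> has norm at most
    \<open>2 * E \<delta> / (a * \<delta>)\<close>, and the Hessian \<open>2 * k\<close> times the
    identity has norm of order \<open>E \<delta> / \<delta>\<^sup>2\<close>. \<open>B\<close> is the
    sum of the two constants, so \<open>B * E \<delta>\<close> controls both at once.\<close>
  define B where "B = (2 * a + 2 * norm (mat 1 :: real^'n^'n)) / a\<^sup>2"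
  have "((\<lambda>\<delta>. B * E \<delta>) \<longlongrightarrow> 0) (at_right 0)"
    using E0 by (auto intro!: tendsto_eq_intros)
  then obtain \<omega> where \<omega>: "modulus_of_continuity \<omega>" "\<forall>\<^sub>F \<delta> in at_right 0. B * E \<delta> \<le> \<omega> \<delta>"
    using modulus_of_continuity_majorant by blast
  have "\<forall>\<^sub>F \<delta> in at_right (0::real). 0 < \<delta> \<and> \<delta> < min d0 (\<rho>/2)"
    unfolding eventually_at_right_field using inner(1) \<rho>
    by (intro exI[of _ "min d0 (\<rho>/2)"]) simp
  moreover have "\<forall>\<^sub>F \<delta> in at_right 0. E \<delta> < \<eta>\<^sup>2"
    using E0 \<eta> by (intro order_tendstoD(2)) auto
  ultimately have "\<forall>\<^sub>F \<delta> in at_right 0. 0 < \<delta> \<and> \<delta> < min d0 (\<rho>/2) \<and> E \<delta> < \<eta>\<^sup>2 \<and> B * E \<delta> \<le> \<omega> \<delta> \<and>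
      (\<forall>x r p X. x \<in> \<Omega> \<longrightarrow> norm (x - x0) \<le> \<delta> \<longrightarrow> norm p \<le> \<omega> \<delta> / \<delta> \<longrightarrow>
         X \<in> sym_matrices \<longrightarrow> norm X \<le> \<omega> \<delta> / \<delta>\<^sup>2 \<longrightarrow> \<bar>H x r p X - G0 r\<bar> \<le> \<epsilon>)"
    using \<omega>(2) sing[OF \<omega>(1) \<epsilon>] by eventually_elim blast
  \<comment> \<open>One \<open>\<delta>\<close> that meets all smallness requirements simultaneously
    is enough for the contradiction.\<close>
  from eventually_happens'[OF trivial_limit_at_right_real this] obtain \<delta> where
    \<delta>: "0 < \<delta>" "\<delta> < d0" "\<delta> < \<rho>/2" "E \<delta> < \<eta>\<^sup>2" "B * E \<delta> \<le> \<omega> \<delta>"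
    and H: "\<And>x r p X. x \<in> \<Omega> \<Longrightarrow> norm (x - x0) \<le> \<delta> \<Longrightarrow> norm p \<le> \<omega> \<delta> / \<delta> \<Longrightarrow>
         X \<in> sym_matrices \<Longrightarrow> norm X \<le> \<omega> \<delta> / \<delta>\<^sup>2 \<Longrightarrow> \<bar>H x r p X - G0 r\<bar> \<le> \<epsilon>"
    unfolding min_less_iff_conj by blast
  define \<xi> where "\<xi> = X0 \<delta>"
  define C where "C = cball \<xi> (a * \<delta>) \<times> {t0 - \<eta>..t0 + \<eta>}"
  have \<xi>: "\<xi> \<in> \<Omega>" using X0 \<delta> by (simp add: \<xi>_def)
  have ball_sub: "cball \<xi> (a * \<delta>) \<subseteq> \<Omega>" using inner(4) \<delta> by (simp add: \<xi>_def X0_def)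
  have I: "t \<in> {0<..<T}" if "t \<in> {t0 - \<eta>..t0 + \<eta>}" for t
    using that \<eta> \<rho> by auto
  have C_sub: "C \<subseteq> \<Omega>T" unfolding C_def \<Omega>T_def using ball_sub I by auto
  \<comment> \<open>The normalisation \<open>norm \<mu> + a \<le> 1\<close> places the whole ball
    within distance \<open>\<delta>\<close> of \<open>x0\<close>, the range on which the bound
    \<open>H\<close> is available.\<close>
  have x_near: "norm (x - x0) \<le> \<delta>" if "x \<in> cball \<xi> (a * \<delta>)" for x
  proof -
    have "norm (x - x0) \<le> norm (x - \<xi>) + norm (\<xi> - x0)"
      using norm_triangle_ineq[of "x - \<xi>" "\<xi> - x0"] by simp
    also have "\<dots> \<le> a * \<delta> + \<delta> * norm \<mu>"
      using that \<delta> by (intro add_mono) (auto simp: \<xi>_def X0_def dist_norm norm_minus_commute)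
    also have "\<dots> = (norm \<mu> + a) * \<delta>" by (simp add: algebra_simps)
    also have "\<dots> \<le> 1 * \<delta>" using inner(3) \<delta> by (intro mult_right_mono) auto
    finally show ?thesis by simp
  qed
  have near: "dist (G0 (v w)) (G0 (v z0)) < \<epsilon>" "dist (f' w) (f' z0) < \<epsilon>" "v w - \<phi> w \<le> M"
    if "w \<in> C" for w
  proof -
    obtain x t where w: "w = (x, t)" by fastforce
    have "dist w z0 \<le> dist x x0 + dist t t0"
      unfolding w z0_def dist_Pair_Pair by (rule sqrt_sum_squares_le_sum) auto
    also have "\<dots> \<le> \<delta> + \<eta>"
      using that x_near[of x] w by (intro add_mono) (auto simp: C_def dist_norm)
    also have "\<dots> < \<rho>1" using \<delta> \<eta> \<rho> by linarith
    finally have "dist w z0 < \<rho>1" .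
    then show "dist (G0 (v w)) (G0 (v z0)) < \<epsilon>" "dist (f' w) (f' z0) < \<epsilon>" "v w - \<phi> w \<le> M"
      using near1[of w] that C_sub sub by auto
  qed
  \<comment> \<open>On the lateral boundary of \<open>C\<close> the penalty equals \<open>E \<delta>\<close>, more than the error \<open>L * \<delta> + e \<delta>\<close>.\<close>
  define k where "k = E \<delta> / (a * \<delta>)\<^sup>2"
  have e_nonneg: "e \<delta> \<ge> 0" by (simp add: e_def)
  have E_pos: "E \<delta> > 0" unfolding E_def using L \<delta> e_nonneg by (intro add_nonneg_pos) auto
  have k: "k > 0" unfolding k_def using E_pos inner \<delta> by simp
  \<comment> \<open>Freezing \<open>\<phi>\<close> at \<open>x = \<xi>\<close> leaves the paraboloid
    as the only source of space derivatives, so no bound on the space derivatives of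
    \<open>\<phi>\<close> enters the arguments of the operator. The term
    \<open>(t - t0)\<^sup>2\<close> localises the maximum in time.\<close>
  define g where "g t = \<phi> (\<xi>, t) + (t - t0)\<^sup>2" for t
  define \<Psi> where "\<Psi> = (\<lambda>(x, t). u (x, t) - (g t + k * (norm (x - \<xi>))\<^sup>2))"
  have "continuous_on C (\<lambda>w. \<phi> (\<xi>, snd w))"
    by (rule continuous_on_compose2[OF cont(1)])
      (use \<xi> I closure_subset in \<open>auto simp: QT_def C_def intro!: continuous_intros\<close>)
  then have "continuous_on C (\<lambda>w. g (snd w) + k * (norm (fst w - \<xi>))\<^sup>2)"
    unfolding g_def by (intro continuous_intros)
  then have "usc_on C (\<lambda>w. u w - (g (snd w) + k * (norm (fst w - \<xi>))\<^sup>2))"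
    using usc_on_subset[OF usc C_sub] by (rule usc_on_diff_continuous[rotated])
  then have "usc_on C \<Psi>" by (simp add: \<Psi>_def case_prod_beta')
  moreover have "compact C" unfolding C_def by (intro compact_Times) auto
  moreover have mid: "(\<xi>, t0) \<in> C" unfolding C_def using inner \<delta> \<eta> by auto
  ultimately obtain m where m: "m \<in> C" "\<And>w. w \<in> C \<Longrightarrow> \<Psi> w \<le> \<Psi> m"
    using usc_on_attains_max[of C \<Psi>] by blast
  obtain y s where ys: "m = (y, s)" by fastforce
  have mC: "(y, s) \<in> C" using m ys by simp
  then have y: "y \<in> cball \<xi> (a * \<delta>)" and s: "s \<in> {t0 - \<eta>..t0 + \<eta>}" by (auto simp: C_def)
  have \<xi>s: "(\<xi>, s) \<in> C" using s inner \<delta> by (auto simp: C_def)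
  have lip: "\<phi> (y, s) - \<phi> (\<xi>, s) \<le> L * \<delta>"
  proof -
    have "norm (\<phi> (y, s) - \<phi> (\<xi>, s)) \<le> L * norm ((y, s) - (\<xi>, s))"
    proof (rule differentiable_bound)
      show "convex C" unfolding C_def by (intro convex_Times) auto
      show "(y, s) \<in> C" "(\<xi>, s) \<in> C" by fact+
      fix w assume w: "w \<in> C"
      show "(\<phi> has_derivative blinfun_apply (f' w)) (at w within C)"
        by (rule has_derivative_at_withinI[OF der(1)[OF subsetD[OF C_sub w]]])
      have "norm (f' w) \<le> L"
        using near(2)[OF w] norm_triangle_ineq2[of "f' w" "f' z0"] by (simp add: L_def dist_norm)
      then show "onorm (blinfun_apply (f' w)) \<le> L" by (simp add: norm_blinfun.rep_eq)
    qed
    also have "\<dots> = L * norm (y - \<xi>)" by (simp add: norm_Pair)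
    also have "\<dots> \<le> L * \<delta>"
    proof -
      have "norm (y - \<xi>) \<le> a * \<delta>" using y by (simp add: dist_norm norm_minus_commute)
      also have "\<dots> \<le> 1 * \<delta>"
        using inner(3) norm_ge_zero[of \<mu>] \<delta> by (intro mult_right_mono) linarith+
      finally show ?thesis using L by (intro mult_left_mono) auto
    qed
    finally show ?thesis by simp
  qed
  \<comment> \<open>Comparing \<open>\<Psi>\<close> at the centre and at the maximum point bounds
    the two penalties together by \<open>L * \<delta> + e \<delta>\<close>, which is less than
    \<open>E \<delta>\<close>.\<close>
  have "M - e \<delta> \<le> v (\<xi>, t0) - \<phi> (\<xi>, t0)" by (simp add: e_def \<xi>_def)
  also have "\<dots> = \<Psi> (\<xi>, t0)" using eq mid C_sub by (auto simp: \<Psi>_def g_def)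
  also have "\<dots> \<le> \<Psi> (y, s)" using m mid ys by simp
  also have "\<dots> = (v (y, s) - \<phi> (y, s)) + (\<phi> (y, s) - \<phi> (\<xi>, s)) - (s - t0)\<^sup>2 - k * (norm (y - \<xi>))\<^sup>2"
    using eq[of "(y, s)"] mC C_sub by (auto simp: \<Psi>_def g_def)
  also have "\<dots> \<le> M + L * \<delta> - (s - t0)\<^sup>2 - k * (norm (y - \<xi>))\<^sup>2"
    using near(3)[OF mC] lip by simp
  finally have "(s - t0)\<^sup>2 + k * (norm (y - \<xi>))\<^sup>2 < E \<delta>"
    using \<delta> by (simp add: E_def)
  moreover have "0 \<le> (s - t0)\<^sup>2" "0 \<le> k * (norm (y - \<xi>))\<^sup>2" using k by auto
  ultimately have small: "(s - t0)\<^sup>2 < E \<delta>" "k * (norm (y - \<xi>))\<^sup>2 < E \<delta>" by linarith+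
  \<comment> \<open>Each penalty alone is below \<open>E \<delta>\<close>. The bound
    \<open>E \<delta> < \<eta>\<^sup>2\<close> then excludes the top and bottom of the cylinder, and
    the choice of \<open>k\<close> excludes the lateral boundary.\<close>
  have s_int: "\<bar>s - t0\<bar> < \<eta>"
  proof (rule power2_less_imp_less)
    show "\<bar>s - t0\<bar>\<^sup>2 < \<eta>\<^sup>2" using small \<delta> by simp
  qed (use \<eta> in simp)
  have y_int: "norm (y - \<xi>) < a * \<delta>"
  proof (rule power2_less_imp_less)
    have "E \<delta> * (norm (y - \<xi>))\<^sup>2 < E \<delta> * (a * \<delta>)\<^sup>2"
      using small(2) inner \<delta> by (simp add: k_def pos_divide_less_eq)
    then show "(norm (y - \<xi>))\<^sup>2 < (a * \<delta>)\<^sup>2" using E_pos by simp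
  qed (use inner \<delta> in simp)
  have "local_max_on \<Omega>T \<Psi> (y, s)"
    unfolding local_max_on_def eventually_at_topological
  proof (intro conjI exI ballI impI)
    show "(y, s) \<in> \<Omega>T" using mC C_sub by auto
    show "open (ball \<xi> (a * \<delta>) \<times> {t0 - \<eta><..<t0 + \<eta>})" by (intro open_Times) auto
    show "(y, s) \<in> ball \<xi> (a * \<delta>) \<times> {t0 - \<eta><..<t0 + \<eta>}"
      using y_int s_int by (auto simp: dist_norm norm_minus_commute)
    fix w assume "w \<in> ball \<xi> (a * \<delta>) \<times> {t0 - \<eta><..<t0 + \<eta>}"
    then show "\<Psi> w \<le> \<Psi> (y, s)" using m(2)[of w] ys by (auto simp: C_def)
  qed
  moreover define g' where "g' t = blinfun_apply (f' (\<xi>, t)) (0, 1) + 2 * (t - t0)" for t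
  moreover define g'' where "g'' t = blinfun_apply (blinfun_apply (f'' (\<xi>, t)) (0, 1)) (0, 1) + 2" for t
  moreover have \<xi>T: "(\<xi>, t) \<in> \<Omega>T" if "t \<in> {0<..<T}" for t using that \<xi> by (simp add: \<Omega>T_def)
  moreover have "(g has_real_derivative g' t) (at t)" if "t \<in> {0<..<T}" for t
    unfolding g_def g'_def
    by (auto intro!: derivative_eq_intros has_real_derivative_slice der(1) \<xi>T that)
  moreover have "(g' has_real_derivative g'' t) (at t)" if "t \<in> {0<..<T}" for t
  proof -
    have "((\<lambda>w. blinfun_apply (f' w) (0, 1)) has_derivative (\<lambda>h. blinfun_apply (f'' (\<xi>, t) h) (0, 1))) (at (\<xi>, t))"
      using der(2)[OF \<xi>T[OF that]] by (auto intro!: derivative_eq_intros)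
    from has_real_derivative_slice[OF this]
    have "((\<lambda>t. blinfun_apply (f' (\<xi>, t)) (0, 1)) has_real_derivative
        blinfun_apply (blinfun_apply (f'' (\<xi>, t)) (0, 1)) (0, 1)) (at t)" .
    then show ?thesis unfolding g'_def g''_def by (auto intro!: derivative_eq_intros)
  qed
  moreover have "continuous_on {0<..<T} g''"
  proof -
    have "continuous_on {0<..<T} (\<lambda>t. f'' (\<xi>, t))"
      by (rule continuous_on_compose2[OF cont(3)])
        (use \<xi>T sub in \<open>auto intro!: continuous_intros\<close>)
    then show ?thesis unfolding g''_def by (intro continuous_intros)
  qed
  ultimately have ineq: "g' s + H y (u (y, s)) ((2 * k) *\<^sub>R (y - \<xi>)) ((2 * k) *\<^sub>R mat 1) \<le> 0"
    using mC C_sub unfolding \<Psi>_def by (intro test[of g g' g'']) auto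
  have H_near: "\<bar>H y (u (y, s)) ((2 * k) *\<^sub>R (y - \<xi>)) ((2 * k) *\<^sub>R mat 1) - G0 (u (y, s))\<bar> \<le> \<epsilon>"
  proof (rule H)
    show "y \<in> \<Omega>" using y ball_sub by auto
    show "norm (y - x0) \<le> \<delta>" using x_near y .
    show "(2 * k) *\<^sub>R mat 1 \<in> (sym_matrices :: (real^'n^'n) set)"
      by (simp add: sym_matrices_def transpose_def mat_def vec_eq_iff eq_commute)
    have B: "B * E \<delta> = 2 * k * (a * \<delta>) * \<delta> + 2 * k * norm (mat 1 :: real^'n^'n) * \<delta>\<^sup>2"
      using inner \<delta> by (simp add: B_def k_def field_simps power2_eq_square)
    have "norm ((2 * k) *\<^sub>R (y - \<xi>)) \<le> 2 * k * (a * \<delta>)"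
      using k y_int by simp
    also have "\<dots> \<le> B * E \<delta> / \<delta>"
      using \<delta> k B by (simp add: pos_le_divide_eq)
    also have "\<dots> \<le> \<omega> \<delta> / \<delta>" using \<delta> by (intro divide_right_mono) auto
    finally show "norm ((2 * k) *\<^sub>R (y - \<xi>)) \<le> \<omega> \<delta> / \<delta>" .
    have "norm ((2 * k) *\<^sub>R (mat 1 :: real^'n^'n)) = 2 * k * norm (mat 1 :: real^'n^'n)"
      using k by simp
    also have "\<dots> \<le> B * E \<delta> / \<delta>\<^sup>2"
      using \<delta> k B inner by (simp add: pos_le_divide_eq)
    also have "\<dots> \<le> \<omega> \<delta> / \<delta>\<^sup>2" using \<delta> by (intro divide_right_mono) auto
    finally show "norm ((2 * k) *\<^sub>R (mat 1 :: real^'n^'n)) \<le> \<omega> \<delta> / \<delta>\<^sup>2" .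
  qed
  have G0_near: "\<bar>G0 (u (y, s)) - G0 (v z0)\<bar> < \<epsilon>"
    using near(1)[OF mC] eq[of "(y, s)"] mC C_sub by (auto simp: dist_real_def)
  have g'_near: "g' s \<ge> D - 2 * \<epsilon>"
  proof -
    have "\<bar>blinfun_apply (f' (\<xi>, s)) (0, 1) - D\<bar> \<le> \<epsilon>"
      using norm_blinfun[of "f' (\<xi>, s) - f' z0" "(0, 1)"] near(2)[OF \<xi>s]
      by (simp add: D_def blinfun.diff_left norm_Pair_0_1 dist_norm)
    moreover have "D - 2 * \<epsilon> \<le> p + 2 * (s - t0)" if "\<bar>p - D\<bar> \<le> \<epsilon>" for p
      using that s_int \<eta>(3) by argo
    ultimately show ?thesis unfolding g'_def by blast
  qed
  \<comment> \<open>Here \<open>p\<close>, \<open>h\<close>, \<open>r\<close>, \<open>c\<close>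
    stand for \<open>g' s\<close>, the value of \<open>H\<close>, \<open>G0 (u (y, s))\<close> and
    \<open>G0 (v z0)\<close>; what remains is linear arithmetic.\<close>
  have "D + c \<le> 4 * \<epsilon>"
    if "p + h \<le> 0" "\<bar>h - r\<bar> \<le> \<epsilon>" "\<bar>r - c\<bar> < \<epsilon>" "p \<ge> D - 2 * \<epsilon>" for p h r c
    using that by argo
  from this[OF ineq H_near G0_near g'_near] have "D + G0 (v z0) \<le> 4 * \<epsilon>" .
  then show False using \<epsilon> by (simp add: \<epsilon>_def)
qed

section \<open>Unpacking the hypotheses and changing signs\<close>

lemma inner_cone_at:
  fixes \<Omega> :: "(real^'n) set"
  assumes "uniform_inner_ball_property \<Omega>" "x0 \<in> frontier \<Omega>"
  obtains \<mu> :: "real^'n" and a d0 :: real where "d0 > 0" "a > 0" "norm \<mu> + a \<le> 1"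
    "\<And>\<delta>. 0 < \<delta> \<Longrightarrow> \<delta> < d0 \<Longrightarrow> cball (x0 + \<delta> *\<^sub>R \<mu>) (a * \<delta>) \<subseteq> \<Omega>"
proof -
  have "\<forall>\<^sub>F s in at_right 0. \<exists>(\<nu> :: real^'n \<Rightarrow> real^'n) c.
      continuous_on (closure \<Omega> \<inter> ball x0 s) \<nu> \<and> c > 0 \<and>
      (\<forall>y \<in> closure \<Omega> \<inter> ball x0 s. \<forall>\<tau>. 0 < \<tau> \<and> \<tau> \<le> c \<longrightarrow> ball (y + \<tau> *\<^sub>R \<nu> y) (c * \<tau>) \<subseteq> \<Omega>)"
    using assms unfolding uniform_inner_ball_property_def by blast
  moreover have "\<forall>\<^sub>F s in at_right (0::real). 0 < s"
    by (rule eventually_at_right_less)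
  ultimately have "\<forall>\<^sub>F s in at_right 0. \<exists>(\<nu> :: real^'n \<Rightarrow> real^'n) c. 0 < s \<and> c > 0 \<and>
      (\<forall>y \<in> closure \<Omega> \<inter> ball x0 s. \<forall>\<tau>. 0 < \<tau> \<and> \<tau> \<le> c \<longrightarrow> ball (y + \<tau> *\<^sub>R \<nu> y) (c * \<tau>) \<subseteq> \<Omega>)"
    by eventually_elim blast
  from eventually_happens'[OF trivial_limit_at_right_real this]
  obtain s c :: real and \<nu> :: "real^'n \<Rightarrow> real^'n" where s: "s > 0" and c: "c > 0"
    and ball: "\<And>y \<tau>. y \<in> closure \<Omega> \<inter> ball x0 s \<Longrightarrow> 0 < \<tau> \<Longrightarrow> \<tau> \<le> c \<Longrightarrow>
      ball (y + \<tau> *\<^sub>R \<nu> y) (c * \<tau>) \<subseteq> \<Omega>"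
    by blast
  have x0: "x0 \<in> closure \<Omega> \<inter> ball x0 s" using assms(2) s by (simp add: frontier_def)
  \<comment> \<open>The inner ball property is applied at \<open>y = x0\<close> with
    \<open>\<tau> = \<delta> / A\<close>. Dividing by \<open>A\<close> gives
    \<open>norm \<mu> + a \<le> 1\<close> for \<open>\<mu> = \<nu> x0 / A\<close>, the condition
    \<open>\<delta> < c * A\<close> gives \<open>\<tau> < c\<close>, and halving the radius fits a
    closed ball into the open one.\<close>
  define A where "A = norm (\<nu> x0) + c"
  have A: "A > 0" unfolding A_def using c by (intro add_nonneg_pos) auto
  show thesis
  proof (rule that)
    show "c * A > 0" "c / (2 * A) > 0" using c A by auto
    have "norm ((1 / A) *\<^sub>R \<nu> x0) + c / (2 * A) \<le> norm (\<nu> x0) / A + c / A"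
      using c A by (simp add: field_simps)
    also have "\<dots> = 1" using A by (simp add: A_def add_divide_distrib[symmetric])
    finally show "norm ((1 / A) *\<^sub>R \<nu> x0) + c / (2 * A) \<le> 1" .
    fix \<delta> assume \<delta>: "0 < \<delta>" "\<delta> < c * A"
    have "cball (x0 + \<delta> *\<^sub>R (1 / A) *\<^sub>R \<nu> x0) (c / (2 * A) * \<delta>)
        \<subseteq> ball (x0 + (\<delta> / A) *\<^sub>R \<nu> x0) (c * (\<delta> / A))"
    proof -
      have "c / (2 * A) * \<delta> < c * (\<delta> / A)" using c A \<delta> by (simp add: field_simps)
      moreover have "\<delta> *\<^sub>R (1 / A) *\<^sub>R \<nu> x0 = (\<delta> / A) *\<^sub>R \<nu> x0" by simp
      ultimately show ?thesis by (simp only: cball_subset_ball_iff simp_thms dist_self add_0)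
    qed
    also have "\<dots> \<subseteq> \<Omega>" using \<delta> A by (intro ball[OF x0]) (simp_all add: pos_divide_le_eq)
    finally show "cball (x0 + \<delta> *\<^sub>R (1 / A) *\<^sub>R \<nu> x0) (c / (2 * A) * \<delta>) \<subseteq> \<Omega>" .
  qed
qed

lemma singular_limit_at_eventually:
  fixes \<Omega> :: "(real^'n) set"
  assumes "singular_limit_at \<Omega> H x0 G0" "modulus_of_continuity \<omega>" "\<epsilon> > 0"
  shows "\<forall>\<^sub>F \<delta> in at_right 0. \<forall>x r p X. x \<in> \<Omega> \<longrightarrow> norm (x - x0) \<le> \<delta> \<longrightarrow> norm p \<le> \<omega> \<delta> / \<delta> \<longrightarrow>
    X \<in> sym_matrices \<longrightarrow> norm X \<le> \<omega> \<delta> / \<delta>\<^sup>2 \<longrightarrow> \<bar>H x r p X - G0 r\<bar> \<le> \<epsilon>"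
proof -
  define S where "S \<delta> = {(x :: real^'n, r :: real, p :: real^'n, X :: real^'n^'n). x \<in> \<Omega> \<and> norm (x - x0) \<le> \<delta> \<and>
                 norm p \<le> \<omega> \<delta> / \<delta> \<and> X \<in> sym_matrices \<and> norm X \<le> \<omega> \<delta> / \<delta>\<^sup>2}" for \<delta>
  define f where "f = (\<lambda>(x, r, p, X). ereal \<bar>H x r p X - G0 r\<bar>)"
  have "((\<lambda>\<delta>. SUP w\<in>S \<delta>. f w) \<longlongrightarrow> 0) (at_right 0)"
    using assms(1,2) unfolding singular_limit_at_def S_def f_def by blast
  then have "\<forall>\<^sub>F \<delta> in at_right 0. (SUP w\<in>S \<delta>. f w) < ereal \<epsilon>"
    using assms(3) by (intro order_tendstoD(2)) auto
  then show ?thesis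
  proof eventually_elim
    case (elim \<delta>)
    have "\<bar>H x r p X - G0 r\<bar> \<le> \<epsilon>" if "(x, r, p, X) \<in> S \<delta>" for x r p X
    proof -
      have "f (x, r, p, X) \<le> (SUP w\<in>S \<delta>. f w)" using that by (rule SUP_upper)
      also note elim
      finally show ?thesis by (simp add: f_def)
    qed
    then show ?case unfolding S_def by blast
  qed
qed

lemma C2_up_to_uminus:
  assumes "C2_up_to U S f"
  shows "C2_up_to U S (\<lambda>x. - f x)"
proof -
  obtain f' f'' where "\<And>x. x \<in> U \<Longrightarrow> (f has_derivative blinfun_apply (f' x)) (at x)"
      "\<And>x. x \<in> U \<Longrightarrow> (f' has_derivative blinfun_apply (f'' x)) (at x)"
      "continuous_on S f" "continuous_on S f'" "continuous_on S f''"
    using assms unfolding C2_up_to_def by blast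
  then show ?thesis
    unfolding C2_up_to_def
    by (intro exI[of _ "\<lambda>x. - f' x"] exI[of _ "\<lambda>x. - f'' x"])
      (auto intro!: continuous_intros derivative_eq_intros simp: blinfun.minus_left)
qed

text \<open>\<open>time_deriv\<close> is built on \<open>deriv\<close>, which is informative only
  where a derivative exists. Existence at boundary points comes from the continuous extension, and
  only then may the sign be pulled out.\<close>

lemma time_deriv_uminus:
  fixes \<Omega> :: "(real^'n) set"
  assumes "C2_up_to (\<Omega> \<times> I) (closure \<Omega> \<times> I) \<phi>" "open I" "(x0, t0) \<in> closure \<Omega> \<times> I"
  shows "time_deriv (\<lambda>w. - \<phi> w) (x0, t0) = - time_deriv \<phi> (x0, t0)"
proof -
  obtain f' where "\<And>w. w \<in> \<Omega> \<times> I \<Longrightarrow> (\<phi> has_derivative blinfun_apply (f' w)) (at w)"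
      "continuous_on (closure \<Omega> \<times> I) \<phi>" "continuous_on (closure \<Omega> \<times> I) f'"
    using assms(1) unfolding C2_up_to_def by blast
  then have der: "((\<lambda>t. \<phi> (x0, t)) has_real_derivative blinfun_apply (f' (x0, t0)) (0, 1)) (at t0)"
    using assms(2,3) by (intro has_time_derivative_up_to_boundary) auto
  show ?thesis
    using DERIV_imp_deriv[OF der] DERIV_imp_deriv[OF DERIV_minus[OF der]]
    by (simp add: time_deriv_def)
qed

theorem proposition4p2:
  fixes \<Omega> :: "(real^'n) set"
    and H :: "real^'n \<Rightarrow> real \<Rightarrow> real^'n \<Rightarrow> real^'n^'n \<Rightarrow> real"
    and T t0 :: real and x0 :: "real^'n" and G0 :: "real \<Rightarrow> real"
  defines "\<Omega>T \<equiv> \<Omega> \<times> {0<..<T}"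
    and "QT \<equiv> closure \<Omega> \<times> {0<..<T}"
  assumes "open \<Omega>" and "connected \<Omega>" and "\<Omega> \<noteq> {}"
    and "uniform_inner_ball_property \<Omega>"
    and "continuous_on (\<Omega> \<times> UNIV \<times> UNIV \<times> sym_matrices) (\<lambda>(x, r, p, X). H x r p X)"
    and "elliptic_on \<Omega> H"
    and "T > 0" and "x0 \<in> frontier \<Omega>" and "0 < t0" and "t0 < T"
    and "continuous_on UNIV G0"
    and "singular_limit_at \<Omega> H x0 G0"
  shows "(\<forall>u. bounded (u ` \<Omega>T) \<and> visc_subsolution \<Omega> T H u \<and>
            continuous (at (x0, t0) within QT) (upper_envelope \<Omega>T u) \<longrightarrow>
            (\<forall>\<phi>. C2_up_to \<Omega>T QT \<phi> \<and>
               local_max_on QT (\<lambda>w. upper_envelope \<Omega>T u w - \<phi> w) (x0, t0) \<longrightarrow>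
               time_deriv \<phi> (x0, t0) + G0 (upper_envelope \<Omega>T u (x0, t0)) \<le> 0)) \<and>
         (\<forall>u. bounded (u ` \<Omega>T) \<and> visc_supersolution \<Omega> T H u \<and>
            continuous (at (x0, t0) within QT) (lower_envelope \<Omega>T u) \<longrightarrow>
            (\<forall>\<phi>. C2_up_to \<Omega>T QT \<phi> \<and>
               local_min_on QT (\<lambda>w. lower_envelope \<Omega>T u w - \<phi> w) (x0, t0) \<longrightarrow>
               time_deriv \<phi> (x0, t0) + G0 (lower_envelope \<Omega>T u (x0, t0)) \<ge> 0))"
proof -
  obtain \<mu> :: "real^'n" and a d0 :: real where cone: "d0 > 0" "a > 0" "norm \<mu> + a \<le> 1"
    "\<And>\<delta>. 0 < \<delta> \<Longrightarrow> \<delta> < d0 \<Longrightarrow> cball (x0 + \<delta> *\<^sub>R \<mu>) (a * \<delta>) \<subseteq> \<Omega>"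
    by (rule inner_cone_at[OF assms(6,10)]) (rule that, assumption+)
  note sing = singular_limit_at_eventually[OF assms(14)]
  have sub: "time_deriv \<phi> (x0, t0) + G0 (upper_envelope \<Omega>T u (x0, t0)) \<le> 0"
    if u: "bounded (u ` \<Omega>T)" "visc_subsolution \<Omega> T H u"
        "continuous (at (x0, t0) within QT) (upper_envelope \<Omega>T u)"
      and \<phi>: "C2_up_to \<Omega>T QT \<phi>" "local_max_on QT (\<lambda>w. upper_envelope \<Omega>T u w - \<phi> w) (x0, t0)"
    for u \<phi>
  proof -
    have usc: "usc_on (\<Omega> \<times> {0<..<T}) u"
      using u(2) unfolding visc_subsolution_def Let_def by blast
    show ?thesis
    proof (rule boundary_viscosity_inequality[OF assms(11,12) cone assms(13), where H = H and u = u])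
      show "upper_envelope \<Omega>T u w = u w" if "w \<in> \<Omega> \<times> {0<..<T}" for w
        using upper_envelope_eq[OF u(1) usc[folded \<Omega>T_def]] that by (simp add: \<Omega>T_def)
    next
      fix g g' g'' :: "real \<Rightarrow> real" and k s :: real and b y :: "real^'n"
      assume "\<And>t. t \<in> {0<..<T} \<Longrightarrow> (g has_real_derivative g' t) (at t)"
          "\<And>t. t \<in> {0<..<T} \<Longrightarrow> (g' has_real_derivative g'' t) (at t)"
          "continuous_on {0<..<T} g''" "(y, s) \<in> \<Omega> \<times> {0<..<T}"
          "local_max_on (\<Omega> \<times> {0<..<T}) (\<lambda>(x, t). u (x, t) - (g t + k * (norm (x - b))\<^sup>2)) (y, s)"
      then show "g' s + H y (u (y, s)) ((2 * k) *\<^sub>R (y - b)) ((2 * k) *\<^sub>R mat 1) \<le> 0"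
        by (rule visc_subsolution_quadratic[OF u(2)])
    qed (use usc u(3) \<phi> in \<open>simp_all only: \<Omega>T_def QT_def sing\<close>)
  qed
  have super: "time_deriv \<phi> (x0, t0) + G0 (lower_envelope \<Omega>T u (x0, t0)) \<ge> 0"
    if u: "bounded (u ` \<Omega>T)" "visc_supersolution \<Omega> T H u"
        "continuous (at (x0, t0) within QT) (lower_envelope \<Omega>T u)"
      and \<phi>: "C2_up_to \<Omega>T QT \<phi>" "local_min_on QT (\<lambda>w. lower_envelope \<Omega>T u w - \<phi> w) (x0, t0)"
    for u \<phi>
  proof -
    define Hm where "Hm = (\<lambda>x r p X. - H x (- r) (- p) (- X))"
    define Gm where "Gm = (\<lambda>r. - G0 (- r))"
    have lsc: "lsc_on (\<Omega> \<times> {0<..<T}) u"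
      using u(2) unfolding visc_supersolution_def Let_def by blast
    have "time_deriv (\<lambda>w. - \<phi> w) (x0, t0) + Gm (- lower_envelope \<Omega>T u (x0, t0)) \<le> 0"
    proof (rule boundary_viscosity_inequality[OF assms(11,12) cone, where H = Hm and ?G0.0 = Gm
          and u = "\<lambda>w. - u w" and v = "\<lambda>w. - lower_envelope \<Omega>T u w" and \<phi> = "\<lambda>w. - \<phi> w"])
      show "continuous_on UNIV Gm"
        unfolding Gm_def by (intro continuous_intros continuous_on_compose2[OF assms(13)]) auto
      show "usc_on (\<Omega> \<times> {0<..<T}) (\<lambda>w. - u w)" using lsc by (simp add: usc_on_uminus_iff)
      show "- lower_envelope \<Omega>T u w = - u w" if "w \<in> \<Omega> \<times> {0<..<T}" for w
        using lower_envelope_eq[OF u(1) lsc[folded \<Omega>T_def]] that by (simp add: \<Omega>T_def)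
      show "continuous (at (x0, t0) within closure \<Omega> \<times> {0<..<T}) (\<lambda>w. - lower_envelope \<Omega>T u w)"
        using u(3) unfolding QT_def by (intro continuous_intros)
      show "local_max_on (closure \<Omega> \<times> {0<..<T}) (\<lambda>w. - lower_envelope \<Omega>T u w - - \<phi> w) (x0, t0)"
        using \<phi>(2) unfolding local_max_on_def local_min_on_def QT_def by (auto elim: eventually_mono)
      show "C2_up_to (\<Omega> \<times> {0<..<T}) (closure \<Omega> \<times> {0<..<T}) (\<lambda>w. - \<phi> w)"
        using C2_up_to_uminus \<phi>(1) unfolding \<Omega>T_def QT_def by blast
    next
      fix \<omega> :: "real \<Rightarrow> real" and \<epsilon> :: real assume "modulus_of_continuity \<omega>" "\<epsilon> > 0"
      from sing[OF this]
      show "\<forall>\<^sub>F \<delta> in at_right 0. \<forall>x r p X. x \<in> \<Omega> \<longrightarrow> norm (x - x0) \<le> \<delta> \<longrightarrow> norm p \<le> \<omega> \<delta> / \<delta> \<longrightarrow>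
         X \<in> sym_matrices \<longrightarrow> norm X \<le> \<omega> \<delta> / \<delta>\<^sup>2 \<longrightarrow> \<bar>Hm x r p X - Gm r\<bar> \<le> \<epsilon>"
      proof eventually_elim
        case (elim \<delta>)
        show ?case
        proof (intro allI impI)
          fix x r and p :: "real^'n" and X :: "real^'n^'n"
          assume "x \<in> \<Omega>" "norm (x - x0) \<le> \<delta>" "norm p \<le> \<omega> \<delta> / \<delta>"
            and "X \<in> sym_matrices" "norm X \<le> \<omega> \<delta> / \<delta>\<^sup>2"
          moreover from this have "- X \<in> sym_matrices"
            by (simp add: sym_matrices_def transpose_def vec_eq_iff)
          \<comment> \<open>The constraints on \<open>p\<close> and \<open>X\<close> are invariant
            under a change of sign and \<open>r\<close> ranges over all reals, so the bound for
            \<open>H\<close> applies at the reflected arguments.\<close>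
          ultimately have "\<bar>H x (- r) (- p) (- X) - G0 (- r)\<bar> \<le> \<epsilon>"
            using elim[rule_format, of x "- p" "- X" "- r"] by simp
          then show "\<bar>Hm x r p X - Gm r\<bar> \<le> \<epsilon>" by (simp add: Hm_def Gm_def abs_minus_commute)
        qed
      qed
    next
      fix g g' g'' :: "real \<Rightarrow> real" and k s :: real and b y :: "real^'n"
      assume g: "\<And>t. t \<in> {0<..<T} \<Longrightarrow> (g has_real_derivative g' t) (at t)"
          "\<And>t. t \<in> {0<..<T} \<Longrightarrow> (g' has_real_derivative g'' t) (at t)"
          "continuous_on {0<..<T} g''"
        and ys: "(y, s) \<in> \<Omega> \<times> {0<..<T}"
        and max: "local_max_on (\<Omega> \<times> {0<..<T})
            (\<lambda>(x, t). - u (x, t) - (g t + k * (norm (x - b))\<^sup>2)) (y, s)"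
      \<comment> \<open>Negation turns the touching paraboloid upside down; the coefficient becomes
        \<open>- k\<close>, which is allowed because the quadratic test lemmas put no sign condition
        on it.\<close>
      have "local_min_on (\<Omega> \<times> {0<..<T}) (\<lambda>(x, t). u (x, t) - (- g t + - k * (norm (x - b))\<^sup>2)) (y, s)"
        unfolding local_min_on_def
      proof
        show "\<forall>\<^sub>F w in at (y, s) within \<Omega> \<times> {0<..<T}.
            (case (y, s) of (x, t) \<Rightarrow> u (x, t) - (- g t + - k * (norm (x - b))\<^sup>2))
            \<le> (case w of (x, t) \<Rightarrow> u (x, t) - (- g t + - k * (norm (x - b))\<^sup>2))"
          using max[unfolded local_max_on_def, THEN conjunct2]
          by eventually_elim (simp add: case_prod_beta')
      qed (rule ys)
      then have "- g' s + H y (u (y, s)) ((2 * - k) *\<^sub>R (y - b)) ((2 * - k) *\<^sub>R mat 1) \<ge> 0"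
        using g ys
        by (intro visc_supersolution_quadratic[OF u(2), where g = "\<lambda>t. - g t" and g' = "\<lambda>t. - g' t" and g'' = "\<lambda>t. - g'' t"])
          (auto intro!: DERIV_minus continuous_intros)
      then show "g' s + Hm y (- u (y, s)) ((2 * k) *\<^sub>R (y - b)) ((2 * k) *\<^sub>R mat 1) \<le> 0"
        by (simp add: Hm_def)
    qed
    moreover have "time_deriv (\<lambda>w. - \<phi> w) (x0, t0) = - time_deriv \<phi> (x0, t0)"
      using assms(10-12) \<phi>(1) unfolding \<Omega>T_def QT_def
      by (intro time_deriv_uminus) (auto simp: frontier_def)
    ultimately show ?thesis by (simp add: Gm_def)
  qed
  show ?thesis using sub super by blast
qed

end
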